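(* Let $N$, $\Pi$ be the counting functions of a Beurling generalized number system with zeta function $\zeta(s)=\int_{1^-}^\infty x^{-s}dN(x)=\exp\left(\int_1^\infty x^{-s}d\Pi(x)\right)$, and suppose $N(x)\sim ax$ for some $a>0$. Suppose there are a discrete set of points $0<t_1<t_2<\dots$ and constants $\beta_1,\beta_2,\dots<1$ such that for each $T>0$ there is $K_T>0$ with $$\log|\zeta(\sigma+it)|>-K_T-\log|\sigma-1+it|+\sum_{0<t_n<T}\beta_n\log|\sigma-1+i(t-t_n)|$$ for every $0<t<T$ and $1<\sigma<2$. Then $m(x)=o(1)$ as $x\to\infty$.
   Context: A Beurling generalized prime system is a non-decreasing unbounded sequence of reals $1<p_1\le p_2\le\dots$; the generalized integers are the multiplicative semigroup generated by the $p_k$ and $1$, listed with multiplicity as $1=n_0<n_1\le n_2\le\dots$. $N(x)=\sum_{n_k\le x}1$, $\pi(x)=\sum_{p_k\le x}1$, $\Pi(x)=\sum_{j\ge1}\frac1j\pi(x^{1/j})$. The measure $dM$ is the multiplicative convolution inverse of $dN$, i.e. $\int_{1^-}^\infty x^{-s}dM(x)=1/\zeta(s)$, and $m(x)=\int_{1^-}^x dM(t)/t$; for discrete systems $m(x)=\sum_{n_k\le x}\mu(n_k)/n_k$ with $\mu$ the Beurling analogue of the Möbius function. *)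

theory Defs
  imports "HOL-Analysis.Analysis" "HOL-Library.Multiset" "HOL-Library.Landau_Symbols"
begin

definition beurling_primes :: "(nat \<Rightarrow> real) \<Rightarrow> bool" where
  "beurling_primes p \<longleftrightarrow> 1 < p 0 \<and> mono p \<and> \<not> bdd_above (range p)"

text \<open>
  A generalized integer, counted with multiplicity, is a finite multiset of indices of
  generalized primes; its value is the product of the corresponding primes. Different
  multisets with the same value are different entries of the list
  \<open>n\<^sub>0 < n\<^sub>1 \<le> n\<^sub>2 \<le> \<dots>\<close>; the empty multiset is \<open>n\<^sub>0 = 1\<close>.
\<close>

definition beurling_int :: "(nat \<Rightarrow> real) \<Rightarrow> nat multiset \<Rightarrow> real" where
  "beurling_int p A = (\<Prod>k\<in>#A. p k)"

definition beurling_N :: "(nat \<Rightarrow> real) \<Rightarrow> real \<Rightarrow> real" where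
  "beurling_N p x = real (card {A. beurling_int p A \<le> x})"

definition beurling_pi :: "(nat \<Rightarrow> real) \<Rightarrow> real \<Rightarrow> real" where
  "beurling_pi p x = real (card {k. p k \<le> x})"

definition beurling_Pi :: "(nat \<Rightarrow> real) \<Rightarrow> real \<Rightarrow> real" where
  "beurling_Pi p x = (\<Sum>j. beurling_pi p (root (Suc j) x) / real (Suc j))"

text \<open>
  The Stieltjes measures \<open>dN\<close> and \<open>d\<Pi>\<close> are \<^const>\<open>interval_measure\<close> of the counting functions.
\<close>

definition beurling_zeta :: "(nat \<Rightarrow> real) \<Rightarrow> complex \<Rightarrow> complex" where
  "beurling_zeta p s =
     (LINT x:{1..}|interval_measure (beurling_N p). complex_of_real x powr (-s))"

definition beurling_mu :: "nat multiset \<Rightarrow> real" where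
  "beurling_mu A = (if \<forall>k. count A k \<le> 1 then (- 1) ^ size A else 0)"

text \<open>
  The measure \<open>dM\<close> has mass \<open>\<mu>(A)\<close> at each generalized integer \<open>A\<close>. That it is the convolution
  inverse of \<open>dN\<close> is \<open>beurling_mu_convolution\<close>, and \<open>\<integral> x\<^sup>-\<^sup>s dM(x) = 1 / \<zeta>(s)\<close> is \<open>beurling_zeta_mu\<close> below;
  \<open>\<integral> dM(t) / t\<close> over \<open>[1, x]\<close> is then the following finite sum.
\<close>

definition beurling_m :: "(nat \<Rightarrow> real) \<Rightarrow> real \<Rightarrow> real" where
  "beurling_m p x = (\<Sum>A | beurling_int p A \<le> x. beurling_mu A / beurling_int p A)"

subsection \<open>The Stieltjes measure of a discrete counting function\<close>

lemma discrete_counting: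
  fixes f w :: "'i \<Rightarrow> real"
  assumes fin: "\<And>x. finite {i. f i \<le> x}" and w: "\<And>i. 0 \<le> w i"
  defines "F \<equiv> \<lambda>x. \<Sum>i | f i \<le> x. w i"
  shows discrete_counting_mono: "mono F"
    and discrete_counting_right_cont: "\<And>x. continuous (at_right x) F"
    and interval_measure_discrete:
      "interval_measure F = distr (density (count_space UNIV) (\<lambda>i. ennreal (w i))) borel f"
proof -
  show mono: "mono F"
    unfolding F_def by (intro monoI sum_mono2 fin) (auto intro: w)
  show cont: "continuous (at_right x) F" for x
  proof -
    define B where "B = f ` {i. f i \<le> x + 1 \<and> x < f i}"
    have finB: "finite B" unfolding B_def
      by (rule finite_imageI, rule finite_subset[OF _ fin[of "x + 1"]]) auto
    define y where "y = Min (insert (x + 1) B)"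
    have "x < y" unfolding y_def using finB by (subst Min_gr_iff) (auto simp: B_def)
    have "F z = F x" if "x < z" "z < y" for z
    proof -
      have "{i. f i \<le> z} = {i. f i \<le> x}"
      proof (intro equalityI subsetI; clarsimp)
        fix i assume i: "f i \<le> z"
        show "f i \<le> x"
        proof (rule ccontr)
          assume "\<not> f i \<le> x"
          moreover have "y \<le> x + 1" unfolding y_def using finB by simp
          ultimately have "f i \<in> B" using i that unfolding B_def by auto
          hence "y \<le> f i" unfolding y_def using finB by simp
          thus False using i that by simp
        qed
      qed (use that in auto)
      thus ?thesis by (simp add: F_def)
    qed
    hence "eventually (\<lambda>z. F z = F x) (at_right x)"
      using \<open>x < y\<close> by (auto simp: eventually_at_right)
    thus ?thesis unfolding continuous_within by (rule tendsto_eventually)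
  qed
  let ?D = "distr (density (count_space UNIV) (\<lambda>i. ennreal (w i))) borel f"
  have IM: "emeasure (interval_measure F) {a<..b} = ennreal (if a \<le> b then F b - F a else 0)" for a b
    by (subst emeasure_interval_measure_Ioc_eq) (use mono cont in \<open>auto simp: mono_def\<close>)
  have D: "emeasure ?D {a<..b} = ennreal (if a \<le> b then F b - F a else 0)" for a b
  proof -
    have fin': "finite {i. a < f i \<and> f i \<le> b}"
      by (rule finite_subset[OF _ fin[of b]]) auto
    have "emeasure ?D {a<..b} = emeasure (density (count_space UNIV) (\<lambda>i. ennreal (w i))) {i. a < f i \<and> f i \<le> b}"
      by (subst emeasure_distr) (auto intro!: arg_cong2[where f = emeasure])
    also have "\<dots> = (\<integral>\<^sup>+i. ennreal (w i) * indicator {i. a < f i \<and> f i \<le> b} i \<partial>count_space UNIV)"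
      by (subst emeasure_density) auto
    also have "\<dots> = (\<Sum>i | a < f i \<and> f i \<le> b. ennreal (w i))"
      by (subst nn_integral_count_space'[OF fin']) (auto simp: indicator_def)
    also have "\<dots> = ennreal (\<Sum>i | a < f i \<and> f i \<le> b. w i)"
      by (rule sum_ennreal) (rule w)
    also have "(\<Sum>i | a < f i \<and> f i \<le> b. w i) = (if a \<le> b then F b - F a else 0)"
    proof (cases "a \<le> b")
      case True
      have "{i. a < f i \<and> f i \<le> b} = {i. f i \<le> b} - {i. f i \<le> a}" by auto
      moreover have "{i. f i \<le> a} \<subseteq> {i. f i \<le> b}" using True by auto
      ultimately show ?thesis using True by (simp add: F_def sum_diff[OF fin])
    next
      case False
      hence "{i. a < f i \<and> f i \<le> b} = {}" by auto
      thus ?thesis using False by (simp only: sum.empty if_False)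
    qed
    finally show ?thesis .
  qed
  have sets: "sets (borel :: real measure) = sigma_sets UNIV (range (\<lambda>(a, b). {a<..b::real}))"
    by (subst borel_sigma_sets_Ioc) simp
  show "interval_measure F = ?D"
  proof (rule measure_eqI_generator_eq[where \<Omega> = UNIV
        and E = "range (\<lambda>(a, b). {a<..b::real})" and A = "\<lambda>n. {- real n<..real n}"])
    show "Int_stable (range (\<lambda>(a, b). {a<..b::real}))"
      by (auto simp: Int_stable_def image_iff Int_greaterThanAtMost)
    show "(\<Union>n. {- real n<..real n}) = UNIV"
    proof (intro set_eqI iffI UNIV_I)
      fix x :: real
      obtain n :: nat where "\<bar>x\<bar> < real n" using reals_Archimedean2 by blast
      thus "x \<in> (\<Union>n. {- real n<..real n})" by (intro UN_I[of n]) auto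
    qed
  qed (auto simp: IM D sets)
qed

lemma LINT_discrete:
  fixes f w :: "'i \<Rightarrow> real" and g :: "real \<Rightarrow> complex"
  assumes fin: "\<And>x. finite {i. f i \<le> x}" and w: "\<And>i. 0 \<le> w i"
    and f1: "\<And>i. 1 \<le> f i" and g: "continuous_on {1..} g"
    and sm: "(\<lambda>i. w i * norm (g (f i))) summable_on UNIV"
  shows "(LINT x:{1..}|interval_measure (\<lambda>x. \<Sum>i | f i \<le> x. w i). g x) =
         (\<Sum>\<^sub>\<infinity>i. of_real (w i) * g (f i))"
proof -
  have "(LINT x:{1..}|interval_measure (\<lambda>x. \<Sum>i | f i \<le> x. w i). g x) =
        (LINT i|density (count_space UNIV) (\<lambda>i. ennreal (w i)). indicator {1..} (f i) *\<^sub>R g (f i))"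
    unfolding interval_measure_discrete[OF fin w] set_lebesgue_integral_def
    by (rule integral_distr)
       (use borel_measurable_continuous_on_indicator[OF _ g] in auto)
  also have "\<dots> = (LINT i|count_space UNIV. w i *\<^sub>R g (f i))"
    by (subst integral_density) (auto simp: f1 w)
  also have "\<dots> = infsetsum (\<lambda>i. of_real (w i) * g (f i)) UNIV"
    by (simp add: infsetsum_def scaleR_conv_of_real)
  also have "\<dots> = (\<Sum>\<^sub>\<infinity>i. of_real (w i) * g (f i))"
    by (rule infsetsum_infsum)
       (use sm w in \<open>simp add: norm_mult flip: abs_summable_equivalent\<close>)
  finally show ?thesis .
qed

subsection \<open>Basic properties\<close>

lemma beurling_primes_gt_1:
  assumes "beurling_primes p" shows "1 < p k"
  using assms unfolding beurling_primes_def by (meson le0 less_le_trans monoD)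

lemma finite_beurling_primes_le:
  assumes "beurling_primes p" shows "finite {k. p k \<le> x}"
proof -
  obtain n where "x < p n"
    using assms unfolding beurling_primes_def bdd_above_def by (auto simp: not_le)
  hence "{k. p k \<le> x} \<subseteq> {..<n}"
    using assms unfolding beurling_primes_def mono_def
    by (auto, metis le_less_trans less_irrefl not_le order_trans)
  thus ?thesis by (rule finite_subset) simp
qed

lemma beurling_int_empty [simp]: "beurling_int p {#} = 1"
  and beurling_int_add_mset [simp]: "beurling_int p (add_mset k A) = p k * beurling_int p A"
  and beurling_int_plus [simp]: "beurling_int p (A + B) = beurling_int p A * beurling_int p B"
  by (simp_all add: beurling_int_def)

lemma beurling_int_ge:
  assumes "beurling_primes p" shows "p 0 ^ size A \<le> beurling_int p A"
proof (induction A)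
  case (add k A)
  have "1 < p 0" "p 0 \<le> p k" using assms unfolding beurling_primes_def by (auto intro: monoD)
  thus ?case using add by (auto intro: mult_mono)
qed simp

lemma beurling_int_ge_1:
  assumes "beurling_primes p" shows "1 \<le> beurling_int p A"
proof -
  have "1 \<le> p 0 ^ size A" using beurling_primes_gt_1[OF assms, of 0] by (simp add: one_le_power)
  thus ?thesis using beurling_int_ge[OF assms, of A] by linarith
qed

lemma finite_beurling_int_le:
  assumes "beurling_primes p" shows "finite {A. beurling_int p A \<le> x}"
proof -
  obtain n where n: "x < p 0 ^ n"
    using real_arch_pow[OF beurling_primes_gt_1[OF assms, of 0]] by blast
  let ?S = "{k. p k \<le> x}"
  have "{A. beurling_int p A \<le> x} \<subseteq> (\<Union>j\<in>{..<n}. {A. set_mset A \<subseteq> ?S \<and> size A = j})"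
  proof clarify
    fix A assume A: "beurling_int p A \<le> x"
    have "p 0 ^ size A < p 0 ^ n" using beurling_int_ge[OF assms, of A] A n by linarith
    hence "size A < n" using beurling_primes_gt_1[OF assms, of 0] by (simp add: power_less_imp_less_exp)
    moreover have "p k \<le> x" if k: "k \<in># A" for k
    proof -
      obtain B where B: "A = add_mset k B" using k by (metis mset_add)
      have "p k * 1 \<le> p k * beurling_int p B"
        using beurling_int_ge_1[OF assms, of B] beurling_primes_gt_1[OF assms, of k]
        by (intro mult_left_mono) auto
      thus ?thesis using A B by simp
    qed
    ultimately show "A \<in> (\<Union>j\<in>{..<n}. {A. set_mset A \<subseteq> ?S \<and> size A = j})" by auto
  qed
  moreover have "finite (\<Union>j\<in>{..<n}. {A. set_mset A \<subseteq> ?S \<and> size A = j})"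
    using finite_beurling_primes_le[OF assms] by (auto simp flip: multisets_of_size_def intro!: finite_UN_I)
  ultimately show ?thesis by (rule finite_subset)
qed

lemma beurling_N_eq_sum: "beurling_N p = (\<lambda>x. \<Sum>A | beurling_int p A \<le> x. 1)"
  by (simp add: beurling_N_def fun_eq_iff)

lemma finite_beurling_prime_powers_le:
  assumes "beurling_primes p" shows "finite {(j, k). p k ^ Suc j \<le> x}"
proof -
  have "(\<lambda>(j, k). replicate_mset (Suc j) k) ` {(j, k). p k ^ Suc j \<le> x} \<subseteq> {A. beurling_int p A \<le> x}"
    by (auto simp: beurling_int_def)
  moreover have "inj_on (\<lambda>(j, k). replicate_mset (Suc j) k) {(j, k). p k ^ Suc j \<le> x}"
    by (auto simp: inj_on_def) (metis add_mset_eq_singleton_iff count_add_mset count_replicate_mset nat.inject zero_less_Suc nat_neq_iff)+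
  ultimately show ?thesis using finite_beurling_int_le[OF assms] by (metis finite_imageD finite_subset)
qed

lemma beurling_Pi_eq_sum:
  assumes "beurling_primes p"
  shows "beurling_Pi p = (\<lambda>x. \<Sum>(j, k) | p k ^ Suc j \<le> x. 1 / real (Suc j))"
proof
  fix x
  let ?S = "{(j, k). p k ^ Suc j \<le> x}"
  have root: "p k \<le> root (Suc j) x \<longleftrightarrow> p k ^ Suc j \<le> x" for j k
  proof -
    have "p k = root (Suc j) (p k ^ Suc j)"
      using beurling_primes_gt_1[OF assms, of k] by (metis real_root_power_cancel zero_less_Suc less_imp_le less_trans zero_less_one)
    thus ?thesis by (metis real_root_le_iff zero_less_Suc)
  qed
  note fin = finite_beurling_prime_powers_le[OF assms, of x]
  have "beurling_Pi p x = (\<Sum>j\<in>fst ` ?S. beurling_pi p (root (Suc j) x) / real (Suc j))"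
    unfolding beurling_Pi_def
  proof (rule suminf_finite)
    fix j assume "j \<notin> fst ` ?S"
    hence "{k. p k \<le> root (Suc j) x} = {}" unfolding root by force
    thus "beurling_pi p (root (Suc j) x) / real (Suc j) = 0" by (simp add: beurling_pi_def)
  qed (use fin in simp)
  also have "\<dots> = (\<Sum>j\<in>fst ` ?S. \<Sum>k | p k ^ Suc j \<le> x. 1 / real (Suc j))"
    unfolding beurling_pi_def root by simp
  also have "\<dots> = (\<Sum>(j, k)\<in>Sigma (fst ` ?S) (\<lambda>j. {k. p k ^ Suc j \<le> x}). 1 / real (Suc j))"
  proof (rule sum.Sigma)
    show "finite (fst ` ?S)" using fin by simp
    show "\<forall>j\<in>fst ` ?S. finite {k. p k ^ Suc j \<le> x}"
      using finite_beurling_primes_le[OF assms, of "root (Suc _) x"] unfolding root by simp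
  qed
  also have "Sigma (fst ` ?S) (\<lambda>j. {k. p k ^ Suc j \<le> x}) = ?S" by force
  finally show "beurling_Pi p x = (\<Sum>(j, k)\<in>?S. 1 / real (Suc j))" .
qed

lemma beurling_mu_convolution:
  "(\<Sum>B | B \<subseteq># A. beurling_mu B) = (if A = {#} then 1 else 0)"
proof -
  have "{B. B \<subseteq># A} \<subseteq> (\<Union>n\<in>{..size A}. multisets_of_size (set_mset A) n)"
    by (auto simp: multisets_of_size_def size_mset_mono dest: mset_subset_eqD)
  hence fin: "finite {B. B \<subseteq># A}"
    by (rule finite_subset) auto
  have "(\<Sum>B | B \<subseteq># A. beurling_mu B) = (\<Sum>B | B \<subseteq># A \<and> (\<forall>k. count B k \<le> 1). (-1) ^ size B)"
    by (rule sum.mono_neutral_cong_right) (use fin in \<open>auto simp: beurling_mu_def\<close>)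
  also have "\<dots> = (\<Sum>S\<in>Pow (set_mset A). (-1) ^ card S)"
  proof (rule sum.reindex_bij_witness[where i = mset_set and j = set_mset])
    fix B assume "B \<in> {B. B \<subseteq># A \<and> (\<forall>k. count B k \<le> 1)}"
    hence *: "B \<subseteq># A" "\<And>k. count B k \<le> 1" by auto
    show B: "mset_set (set_mset B) = B"
    proof (rule multiset_eqI)
      fix k show "count (mset_set (set_mset B)) k = count B k"
        using *(2)[of k] by (cases "count B k") (simp_all add: count_mset_set' not_in_iff flip: count_greater_zero_iff)
    qed
    show "set_mset B \<in> Pow (set_mset A)" using * by (auto dest: mset_subset_eqD)
    show "(-1::real) ^ card (set_mset B) = (-1) ^ size B"
      by (metis B size_mset_set)
  next
    fix S assume S: "S \<in> Pow (set_mset A)"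
    hence finS: "finite S" by (auto intro: finite_subset)
    show "set_mset (mset_set S) = S" using finS by simp
    show "mset_set S \<in> {B. B \<subseteq># A \<and> (\<forall>k. count B k \<le> 1)}"
      using S finS by (auto simp: subseteq_mset_def count_mset_set' Suc_le_eq)
  qed
  also have "\<dots> = (if A = {#} then 1 else 0)"
  proof (cases "A = {#}")
    case False
    then obtain k where k: "k \<in># A" by auto
    let ?P = "Pow (set_mset A - {k})"
    have "Pow (set_mset A) = ?P \<union> insert k ` ?P"
      using k by (metis Pow_insert insert_Diff)
    moreover have "(\<Sum>S\<in>?P \<union> insert k ` ?P. (-1::real) ^ card S) =
        (\<Sum>S\<in>?P. (-1) ^ card S) + (\<Sum>S\<in>insert k ` ?P. (-1) ^ card S)"
      by (rule sum.union_disjoint) auto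
    moreover have "(\<Sum>S\<in>insert k ` ?P. (-1::real) ^ card S) = (\<Sum>S\<in>?P. - ((-1) ^ card S))"
    proof (subst sum.reindex)
      show "inj_on (insert k) ?P"
        by (rule inj_onI) (metis Diff_insert_absorb DiffE PowD insertI1 subsetD)
      show "sum ((\<lambda>S. (-1::real) ^ card S) \<circ> insert k) ?P = (\<Sum>S\<in>?P. - ((-1) ^ card S))"
      proof (rule sum.cong)
        fix S assume "S \<in> ?P"
        hence "finite S" "k \<notin> S" by (auto intro: finite_subset)
        thus "((\<lambda>S. (-1::real) ^ card S) \<circ> insert k) S = - ((-1) ^ card S)" by simp
      qed simp
    qed
    ultimately show ?thesis using False by (simp add: sum_negf)
  qed simp
  finally show ?thesis .
qed

subsection \<open>The zeta function in the half-plane of convergence\<close>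

lemma tendsto_infsum_exhaust:
  fixes f :: "'a \<Rightarrow> complex"
  assumes f: "(\<lambda>x. norm (f x)) summable_on UNIV" and S: "incseq S" "(\<Union>n. S n) = UNIV"
  shows "(\<lambda>n. infsum f (S n)) \<longlonglongrightarrow> infsum f UNIV"
proof (rule tendstoI)
  fix e :: real assume e: "0 < e"
  let ?g = "\<lambda>x. norm (f x)"
  have fs: "f summable_on UNIV" using f by (rule Infinite_Sum.abs_summable_summable)
  obtain F where F: "finite F" "dist (sum ?g F) (infsum ?g UNIV) \<le> e / 2"
    using infsum_finite_approximation[OF f, of "e / 2"] e by auto
  have "eventually (\<lambda>n. \<forall>x\<in>F. x \<in> S n) sequentially"
  proof (rule eventually_ball_finite[OF F(1)], rule ballI)
    fix x
    obtain n0 where "x \<in> S n0" using S(2) by blast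
    thus "eventually (\<lambda>n. x \<in> S n) sequentially"
      using S(1) by (auto simp: eventually_sequentially incseq_def intro!: exI[of _ n0])
  qed
  thus "eventually (\<lambda>n. dist (infsum f (S n)) (infsum f UNIV) < e) sequentially"
  proof eventually_elim
    case (elim n)
    have "infsum f (UNIV - S n) = infsum f UNIV - infsum f (S n)"
      by (rule infsum_Diff) (auto intro: summable_on_subset_banach[OF fs] fs)
    hence "dist (infsum f (S n)) (infsum f UNIV) = norm (infsum f (UNIV - S n))"
      by (simp add: dist_norm norm_minus_commute)
    also have "\<dots> \<le> infsum ?g (UNIV - S n)"
      by (rule norm_infsum_bound) (rule summable_on_subset_banach[OF f], simp)
    also have "\<dots> \<le> infsum ?g (UNIV - F)"
      by (rule infsum_mono2) (use elim in \<open>auto intro: summable_on_subset_banach[OF f]\<close>)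
    also have "\<dots> = infsum ?g UNIV - infsum ?g F"
      by (rule infsum_Diff) (auto intro: summable_on_subset_banach[OF f] f)
    also have "\<dots> \<le> e / 2" using F by (simp add: dist_real_def del: le_divide_eq_numeral1)
    also have "\<dots> < e" using e by simp
    finally show ?case .
  qed
qed

lemma bij_betw_mset_insert:
  assumes "k \<notin> K"
  shows "bij_betw (\<lambda>(j, B). replicate_mset j k + B)
           ((UNIV :: nat set) \<times> {B. set_mset B \<subseteq> K}) {A. set_mset A \<subseteq> insert k K}"
proof (rule bij_betwI')
  fix x y :: "nat \<times> 'a multiset"
  assume x: "x \<in> UNIV \<times> {B. set_mset B \<subseteq> K}" and y: "y \<in> UNIV \<times> {B. set_mset B \<subseteq> K}"
  obtain i A j B where xy: "x = (i, A)" "y = (j, B)" by (metis surj_pair)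
  have 0: "count A k = 0" "count B k = 0"
    using x y assms by (auto simp: xy count_eq_zero_iff)
  have "x = y" if eq: "replicate_mset i k + A = replicate_mset j k + B"
  proof -
    have "i = j" using arg_cong[OF eq, of "\<lambda>X. count X k"] 0 by simp
    thus ?thesis using eq by (simp add: xy)
  qed
  thus "((case x of (j, B) \<Rightarrow> replicate_mset j k + B) = (case y of (j, B) \<Rightarrow> replicate_mset j k + B)) \<longleftrightarrow> x = y"
    by (auto simp: xy)
next
  fix x :: "nat \<times> 'a multiset"
  assume "x \<in> UNIV \<times> {B. set_mset B \<subseteq> K}"
  thus "(case x of (j, B) \<Rightarrow> replicate_mset j k + B) \<in> {A. set_mset A \<subseteq> insert k K}"
    by (auto split: if_splits)
next
  fix A assume A: "A \<in> {A. set_mset A \<subseteq> insert k K}"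
  have "A = replicate_mset (count A k) k + filter_mset (\<lambda>i. i \<noteq> k) A"
    by (rule multiset_eqI) simp
  thus "\<exists>x\<in>UNIV \<times> {B. set_mset B \<subseteq> K}. A = (case x of (j, B) \<Rightarrow> replicate_mset j k + B)"
    using A by (intro bexI[of _ "(count A k, filter_mset (\<lambda>i. i \<noteq> k) A)"]) auto
qed

lemma euler_product_finite:
  fixes z :: "nat \<Rightarrow> complex"
  assumes f: "(\<lambda>A. norm (\<Prod>k\<in>#A. z k)) summable_on UNIV"
    and z: "\<And>k. norm (z k) < 1" and K: "finite K"
  shows "(\<Sum>\<^sub>\<infinity>A | set_mset A \<subseteq> K. \<Prod>k\<in>#A. z k) = (\<Prod>k\<in>K. 1 / (1 - z k))"
  using K
proof (induction K rule: finite_induct)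
  case empty
  have "{A :: nat multiset. set_mset A \<subseteq> {}} = {{#}}" by auto
  thus ?case by simp
next
  case (insert k K)
  let ?f = "\<lambda>A. \<Prod>k\<in>#A. z k"
  note bij = bij_betw_mset_insert[OF insert(2)]
  have fs: "?f summable_on X" for X
    by (rule summable_on_subset_banach[OF Infinite_Sum.abs_summable_summable[OF f]]) simp
  have eq: "?f (case x of (j, B) \<Rightarrow> replicate_mset j k + B) = (case x of (j, B) \<Rightarrow> z k ^ j * ?f B)" for x
    by (cases x) simp
  have sm: "(\<lambda>(j, B). z k ^ j * ?f B) summable_on UNIV \<times> {B. set_mset B \<subseteq> K}"
    using fs[of "{A. set_mset A \<subseteq> insert k K}"]
    unfolding summable_on_reindex_bij_betw[OF bij, symmetric] eq .
  have "(\<Sum>\<^sub>\<infinity>A | set_mset A \<subseteq> insert k K. ?f A) = (\<Sum>\<^sub>\<infinity>(j, B)\<in>UNIV \<times> {B. set_mset B \<subseteq> K}. z k ^ j * ?f B)"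
    unfolding infsum_reindex_bij_betw[OF bij, symmetric] eq ..
  also have "\<dots> = (\<Sum>\<^sub>\<infinity>j. \<Sum>\<^sub>\<infinity>B | set_mset B \<subseteq> K. z k ^ j * ?f B)"
    by (rule infsum_Sigma'_banach[symmetric]) (use sm in simp)
  also have "\<dots> = (\<Sum>\<^sub>\<infinity>j. z k ^ j) * (\<Sum>\<^sub>\<infinity>B | set_mset B \<subseteq> K. ?f B)"
    by (simp add: infsum_cmult_right' infsum_cmult_left')
  also have "(\<Sum>\<^sub>\<infinity>j. z k ^ j) = 1 / (1 - z k)"
  proof (rule infsumI, rule norm_summable_imp_has_sum)
    show "summable (\<lambda>j. norm (z k ^ j))"
      using z[of k] by (simp add: norm_power summable_geometric)
    show "(\<lambda>j. z k ^ j) sums (1 / (1 - z k))" by (rule geometric_sums[OF z])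
  qed
  finally show ?case using insert by simp
qed

lemma euler_product_exp:
  fixes z :: "nat \<Rightarrow> complex"
  assumes f: "(\<lambda>A. norm (\<Prod>k\<in>#A. z k)) summable_on UNIV" and z: "\<And>k. norm (z k) < 1"
  shows "(\<lambda>(j, k). norm (z k ^ Suc j / of_nat (Suc j))) summable_on UNIV"
    and "(\<Sum>\<^sub>\<infinity>A. \<Prod>k\<in>#A. z k) = exp (\<Sum>\<^sub>\<infinity>(j, k). z k ^ Suc j / of_nat (Suc j))"
proof -
  let ?f = "\<lambda>A. \<Prod>k\<in>#A. z k"
  let ?g = "\<lambda>(j, k). z k ^ Suc j / of_nat (Suc j)"
  let ?r = "\<lambda>(j, k :: nat). replicate_mset (Suc j) k"
  have inj: "inj ?r"
  proof (rule injI)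
    fix x y :: "nat \<times> nat" assume xy: "?r x = ?r y"
    obtain j k j' k' where x: "x = (j, k)" and y: "y = (j', k')" by (metis surj_pair)
    have eq: "replicate_mset (Suc j) k = replicate_mset (Suc j') k'" using xy by (simp add: x y)
    hence "size (replicate_mset (Suc j) k) = size (replicate_mset (Suc j') k')"
      and "set_mset (replicate_mset (Suc j) k) = set_mset (replicate_mset (Suc j') k')"
      by (simp_all only:)
    thus "x = y" by (simp add: x y split: if_splits)
  qed
  have "(\<lambda>A. norm (?f A)) summable_on range ?r"
    by (rule summable_on_subset_banach[OF f]) simp
  hence r: "((\<lambda>A. norm (?f A)) \<circ> ?r) summable_on UNIV"
    by (subst (asm) summable_on_reindex[OF inj])
  have g: "(\<lambda>x. norm (?g x)) summable_on UNIV"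
  proof (rule Infinite_Sum.abs_summable_on_comparison_test'[OF r])
    fix x :: "nat \<times> nat"
    obtain j k where x: "x = (j, k)" by fastforce
    have "norm (z k ^ Suc j) / real (Suc j) \<le> norm (z k ^ Suc j) / 1"
      by (rule divide_left_mono) auto
    thus "norm (?g x) \<le> ((\<lambda>A. norm (?f A)) \<circ> ?r) x"
      by (simp add: x norm_divide norm_mult norm_power del: of_nat_Suc)
  qed
  thus "(\<lambda>(j, k). norm (z k ^ Suc j / of_nat (Suc j))) summable_on UNIV"
    by (simp add: case_prod_unfold)
  have gs: "?g summable_on UNIV" using g by (rule Infinite_Sum.abs_summable_summable)

  have lim1: "(\<lambda>n. infsum ?f {A. set_mset A \<subseteq> {..<n}}) \<longlonglongrightarrow> infsum ?f UNIV"
  proof (rule tendsto_infsum_exhaust[OF f])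
    show "incseq (\<lambda>n. {A. set_mset A \<subseteq> {..<n}})"
      by (auto simp: incseq_def subset_iff intro: less_le_trans)
    have "\<exists>n. set_mset A \<subseteq> {..<n}" for A :: "nat multiset"
      using finite_nat_bounded[of "set_mset A"] by simp
    thus "(\<Union>n. {A :: nat multiset. set_mset A \<subseteq> {..<n}}) = UNIV" by (simp add: set_eq_iff)
  qed
  have lim2: "(\<lambda>n. exp (infsum ?g (UNIV \<times> {..<n}))) \<longlonglongrightarrow> exp (infsum ?g UNIV)"
  proof (rule tendsto_exp, rule tendsto_infsum_exhaust[OF g])
    show "incseq (\<lambda>n. (UNIV :: nat set) \<times> {..<n::nat})" by (auto simp: incseq_def)
    show "(\<Union>n. (UNIV :: nat set) \<times> {..<n::nat}) = UNIV"
      by (simp add: set_eq_iff) (meson lessI)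
  qed
  have ln: "(\<Sum>\<^sub>\<infinity>j. z k ^ Suc j / of_nat (Suc j)) = - ln (1 - z k)" for k
  proof (rule infsumI, rule norm_summable_imp_has_sum)
    have "(\<lambda>n. - (z k ^ n) / of_nat n) sums ln (1 - z k)"
      using Ln_series'[of "- z k"] z[of k] by simp
    hence "(\<lambda>n. - (z k ^ Suc n) / of_nat (Suc n)) sums ln (1 - z k)"
      by (subst sums_Suc_iff) simp
    from sums_minus[OF this] show "(\<lambda>j. z k ^ Suc j / of_nat (Suc j)) sums (- ln (1 - z k))" by simp
    show "summable (\<lambda>j. norm (z k ^ Suc j / of_nat (Suc j)))"
    proof (rule summable_comparison_test[OF _ summable_geometric[of "norm (z k)"]])
      have "norm (z k) ^ Suc n / real (Suc n) \<le> norm (z k) ^ n / 1" for n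
        using z[of k] by (intro frac_le) (auto simp: mult_left_le_one_le)
      thus "\<exists>N. \<forall>n\<ge>N. norm (norm (z k ^ Suc n / of_nat (Suc n))) \<le> norm (z k) ^ n"
        by (auto simp: norm_divide norm_power norm_mult simp del: of_nat_Suc)
    qed (use z in simp)
  qed
  have "exp (infsum ?g (UNIV \<times> {..<n})) = infsum ?f {A. set_mset A \<subseteq> {..<n}}" for n
  proof -
    have bij: "bij_betw prod.swap ({..<n} \<times> UNIV) ((UNIV :: nat set) \<times> {..<n})"
      by (auto simp: bij_betw_def inj_on_def image_iff)
    have sw: "(\<lambda>(k, j). z k ^ Suc j / of_nat (Suc j)) summable_on ({..<n} \<times> UNIV)"
      using summable_on_subset_banach[OF gs, of "UNIV \<times> {..<n}"]
      unfolding summable_on_reindex_bij_betw[OF bij, symmetric] by (simp add: case_prod_unfold)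
    have "infsum ?g (UNIV \<times> {..<n}) = (\<Sum>\<^sub>\<infinity>(k, j)\<in>{..<n} \<times> UNIV. z k ^ Suc j / of_nat (Suc j))"
      unfolding infsum_reindex_bij_betw[OF bij, symmetric] by (simp add: case_prod_unfold)
    also have "\<dots> = (\<Sum>\<^sub>\<infinity>k\<in>{..<n}. \<Sum>\<^sub>\<infinity>j. z k ^ Suc j / of_nat (Suc j))"
      by (rule infsum_Sigma'_banach[symmetric]) (use sw in simp)
    also have "\<dots> = (\<Sum>k<n. - ln (1 - z k))" unfolding ln by simp
    finally have "exp (infsum ?g (UNIV \<times> {..<n})) = (\<Prod>k<n. exp (- ln (1 - z k)))"
      by (simp add: exp_sum)
    also have "\<dots> = (\<Prod>k<n. 1 / (1 - z k))"
    proof (rule prod.cong)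
      fix k
      have "1 - z k \<noteq> 0" using z[of k] by auto
      thus "exp (- ln (1 - z k)) = 1 / (1 - z k)" by (simp add: exp_minus inverse_eq_divide)
    qed simp
    also have "\<dots> = infsum ?f {A. set_mset A \<subseteq> {..<n}}"
      by (rule euler_product_finite[OF f z, symmetric]) simp
    finally show ?thesis .
  qed
  thus "infsum ?f UNIV = exp (infsum ?g UNIV)"
    using LIMSEQ_unique[OF lim1] lim2 by simp
qed

lemma beurling_int_powr:
  assumes "beurling_primes p"
  shows "complex_of_real (beurling_int p A) powr (-s) = (\<Prod>k\<in>#A. complex_of_real (p k) powr (-s))"
proof (induction A)
  case (add k A)
  have "0 \<le> p k" "0 \<le> beurling_int p A"
    using beurling_primes_gt_1[OF assms, of k] beurling_int_ge_1[OF assms, of A] by auto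
  thus ?case using add by (simp add: powr_times_real)
qed simp

lemma norm_beurling_int_powr:
  assumes "beurling_primes p"
  shows "norm (complex_of_real (beurling_int p A) powr (-s)) = beurling_int p A powr (- Re s)"
  using beurling_int_ge_1[OF assms, of A] by (subst norm_powr_real_powr) auto

lemma beurling_zeta_eq_infsum:
  assumes p: "beurling_primes p"
    and s: "(\<lambda>A. beurling_int p A powr (- Re s)) summable_on UNIV"
  shows "beurling_zeta p s = (\<Sum>\<^sub>\<infinity>A. complex_of_real (beurling_int p A) powr (-s))"
  unfolding beurling_zeta_def beurling_N_eq_sum
  by (subst LINT_discrete)
     (use s in \<open>auto simp: finite_beurling_int_le[OF p] beurling_int_ge_1[OF p] norm_beurling_int_powr[OF p] intro!: continuous_intros\<close>)

lemma beurling_zeta_eq_exp: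
  assumes p: "beurling_primes p" and s0: "0 < Re s"
    and s: "(\<lambda>A. beurling_int p A powr (- Re s)) summable_on UNIV"
  shows "beurling_zeta p s =
    exp (LINT x:{1..}|interval_measure (beurling_Pi p). complex_of_real x powr (-s))"
proof -
  define z where "z = (\<lambda>k. complex_of_real (p k) powr (-s))"
  have z: "norm (z k) < 1" for k
  proof -
    have "norm (z k) = p k powr (- Re s)"
      unfolding z_def using beurling_primes_gt_1[OF p, of k] by (subst norm_powr_real_powr) auto
    also have "\<dots> < 1" using beurling_primes_gt_1[OF p, of k] s0 by (simp add: powr_less_one)
    finally show ?thesis .
  qed
  have prodz: "complex_of_real (beurling_int p A) powr (-s) = (\<Prod>k\<in>#A. z k)" for A
    unfolding z_def by (rule beurling_int_powr[OF p])
  have sm: "(\<lambda>A. norm (\<Prod>k\<in>#A. z k)) summable_on UNIV"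
    using s unfolding prodz[symmetric] norm_beurling_int_powr[OF p] .
  have pw: "complex_of_real (p k ^ Suc j) powr (-s) = z k ^ Suc j" for j k
    using prodz[of "replicate_mset (Suc j) k"] by (simp add: beurling_int_def)
  have Pi: "beurling_Pi p = (\<lambda>x. \<Sum>i | (case i of (j, k) \<Rightarrow> p k ^ Suc j) \<le> x. case i of (j, k) \<Rightarrow> 1 / real (Suc j))"
    unfolding beurling_Pi_eq_sum[OF p] by (intro ext sum.cong) auto
  have "(LINT x:{1..}|interval_measure (beurling_Pi p). complex_of_real x powr (-s)) =
      (\<Sum>\<^sub>\<infinity>i. complex_of_real (case i of (j, k) \<Rightarrow> 1 / real (Suc j)) *
         (complex_of_real (case i of (j, k) \<Rightarrow> p k ^ Suc j) powr (-s)))"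
    unfolding Pi
  proof (rule LINT_discrete)
    show "finite {i. (case i of (j, k) \<Rightarrow> p k ^ Suc j) \<le> x}" for x
      using finite_beurling_prime_powers_le[OF p, of x] by (simp add: case_prod_unfold)
    show "0 \<le> (case i of (j, k) \<Rightarrow> 1 / real (Suc j))" for i :: "nat \<times> nat"
      by (auto split: prod.split)
    show "1 \<le> (case i of (j, k) \<Rightarrow> p k ^ Suc j)" for i
      using beurling_primes_gt_1[OF p] by (auto split: prod.split intro!: one_le_power less_imp_le simp del: power_Suc)
    show "(\<lambda>i. (case i of (j, k) \<Rightarrow> 1 / real (Suc j)) *
        norm (complex_of_real (case i of (j, k) \<Rightarrow> p k ^ Suc j) powr (-s))) summable_on UNIV"
      using euler_product_exp(1)[OF sm z]
      by (rule back_subst[where P = "\<lambda>h. h summable_on UNIV"])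
         (auto simp: fun_eq_iff pw norm_divide simp del: power_Suc of_nat_Suc of_real_power)
  qed (auto intro!: continuous_intros)
  also have "\<dots> = (\<Sum>\<^sub>\<infinity>(j, k). z k ^ Suc j / of_nat (Suc j))"
    by (intro infsum_cong) (auto simp: pw simp del: power_Suc of_nat_Suc of_real_power)
  finally show ?thesis
    using euler_product_exp(2)[OF sm z] by (simp add: beurling_zeta_eq_infsum[OF p s] prodz)
qed

lemma beurling_zeta_mu:
  assumes p: "beurling_primes p"
    and s: "(\<lambda>A. beurling_int p A powr (- Re s)) summable_on UNIV"
  shows "(\<Sum>\<^sub>\<infinity>A. of_real (beurling_mu A) * complex_of_real (beurling_int p A) powr (-s)) * beurling_zeta p s = 1"
proof -
  define f where "f = (\<lambda>A. complex_of_real (beurling_int p A) powr (-s))"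
  define g where "g = (\<lambda>A. of_real (beurling_mu A) * f A)"
  have f: "(\<lambda>A. norm (f A)) summable_on UNIV"
    using s unfolding f_def norm_beurling_int_powr[OF p] .
  have g: "(\<lambda>A. norm (g A)) summable_on UNIV"
    by (rule Infinite_Sum.abs_summable_on_comparison_test'[OF f])
       (auto simp: g_def norm_mult beurling_mu_def)
  have fplus: "f (A + B) = f A * f B" for A B
    unfolding f_def by (simp add: beurling_int_powr[OF p] flip: beurling_int_plus)
  have sm: "(\<lambda>(A, B). g A * f B) summable_on UNIV \<times> UNIV"
  proof (rule Infinite_Sum.abs_summable_summable)
    have "(\<lambda>(A, B). norm (g A) * norm (f B)) summable_on UNIV \<times> UNIV"
    proof (rule summable_on_SigmaI)
      show "((\<lambda>B. case (A, B) of (A, B) \<Rightarrow> norm (g A) * norm (f B)) has_sum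
              norm (g A) * infsum (\<lambda>B. norm (f B)) UNIV) UNIV" for A
        using has_sum_cmult_right[OF has_sum_infsum[OF f]] by simp
      show "(\<lambda>A. norm (g A) * infsum (\<lambda>B. norm (f B)) UNIV) summable_on UNIV"
        by (rule summable_on_cmult_left[OF g])
    qed auto
    thus "(\<lambda>x. norm (case x of (A, B) \<Rightarrow> g A * f B)) summable_on UNIV \<times> UNIV"
      by (simp add: case_prod_unfold norm_mult)
  qed
  have bij: "bij_betw (\<lambda>(C, A). (A, C - A)) (Sigma UNIV (\<lambda>C. {A. A \<subseteq># C})) (UNIV \<times> UNIV)"
    by (rule bij_betw_byWitness[where f' = "\<lambda>(A, B). (A + B, A)"])
       (auto simp: subset_mset.add_diff_inverse)
  have eq: "(case (case x of (C, A) \<Rightarrow> (A, C - A)) of (A, B) \<Rightarrow> g A * f B) =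
      (case x of (C, A) \<Rightarrow> of_real (beurling_mu A) * f C)"
    if "x \<in> Sigma UNIV (\<lambda>C. {A. A \<subseteq># C})" for x
    using that by (auto simp: g_def mult.assoc subset_mset.add_diff_inverse simp flip: fplus)
  have sm': "(\<lambda>(C, A). of_real (beurling_mu A) * f C) summable_on Sigma UNIV (\<lambda>C. {A. A \<subseteq># C})"
    using sm unfolding summable_on_reindex_bij_betw[OF bij, symmetric]
    by (subst (asm) summable_on_cong[OF eq])
  have fin: "finite {B. B \<subseteq># A}" for A :: "nat multiset"
  proof -
    have "{B. B \<subseteq># A} \<subseteq> (\<Union>n\<in>{..size A}. multisets_of_size (set_mset A) n)"
      by (auto simp: multisets_of_size_def size_mset_mono dest: mset_subset_eqD)
    thus ?thesis by (rule finite_subset) auto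
  qed
  have "infsum g UNIV * infsum f UNIV = (\<Sum>\<^sub>\<infinity>A. \<Sum>\<^sub>\<infinity>B. g A * f B)"
    by (simp add: infsum_cmult_right' infsum_cmult_left')
  also have "\<dots> = (\<Sum>\<^sub>\<infinity>(A, B)\<in>UNIV \<times> UNIV. g A * f B)"
    by (rule infsum_Sigma'_banach) (use sm in simp)
  also have "\<dots> = (\<Sum>\<^sub>\<infinity>(C, A)\<in>Sigma UNIV (\<lambda>C. {A. A \<subseteq># C}). of_real (beurling_mu A) * f C)"
    unfolding infsum_reindex_bij_betw[OF bij, symmetric] by (rule infsum_cong[OF eq])
  also have "\<dots> = (\<Sum>\<^sub>\<infinity>C. \<Sum>\<^sub>\<infinity>A | A \<subseteq># C. of_real (beurling_mu A) * f C)"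
    by (rule infsum_Sigma'_banach[symmetric]) (rule sm')
  also have "\<dots> = (\<Sum>\<^sub>\<infinity>C. of_real (\<Sum>A | A \<subseteq># C. beurling_mu A) * f C)"
    by (intro infsum_cong) (simp add: fin sum_distrib_right)
  also have "\<dots> = (\<Sum>\<^sub>\<infinity>C\<in>{{#}}. f C)"
    unfolding beurling_mu_convolution by (rule infsum_cong_neutral) auto
  also have "\<dots> = 1" by (simp add: f_def)
  finally show ?thesis
    unfolding g_def f_def beurling_zeta_eq_infsum[OF p s] .
qed

lemma beurling_int_powr_summable:
  assumes p: "beurling_primes p" and N: "beurling_N p \<sim>[at_top] (\<lambda>x. a * x)" and \<sigma>: "1 < \<sigma>"
  shows "(\<lambda>A. beurling_int p A powr (-\<sigma>)) summable_on UNIV"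
proof -
  have "beurling_N p \<in> O(\<lambda>x. a * x)" by (rule asymp_equiv_imp_bigo[OF N])
  also have "(\<lambda>x. a * x) \<in> O(\<lambda>x. x)" by simp
  finally obtain c where "eventually (\<lambda>x. norm (beurling_N p x) \<le> c * norm x) at_top"
    by (rule landau_o.bigE)
  then obtain X where X: "\<And>x. X \<le> x \<Longrightarrow> norm (beurling_N p x) \<le> c * norm x"
    by (auto simp: eventually_at_top_linorder)
  have mono: "beurling_N p x \<le> beurling_N p y" if "x \<le> y" for x y
    unfolding beurling_N_def using that
    by (intro of_nat_mono card_mono finite_beurling_int_le[OF p]) auto
  define C where "C = max \<bar>c\<bar> (beurling_N p X)"
  have C: "beurling_N p x \<le> C * x" if "1 \<le> x" for x
  proof (cases "X \<le> x")
    case True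
    have "beurling_N p x \<le> c * x" using X[OF True] that by (simp add: beurling_N_def)
    also have "\<dots> \<le> C * x" using that by (intro mult_right_mono) (auto simp: C_def)
    finally show ?thesis .
  next
    case False
    have "beurling_N p x \<le> C * 1" using mono[of x X] False by (auto simp: C_def)
    also have "\<dots> \<le> C * x" using that by (intro mult_left_mono) (auto simp: C_def)
    finally show ?thesis .
  qed
  let ?n = "beurling_int p"
  define lev where "lev = (\<lambda>A. nat \<lfloor>log 2 (?n A)\<rfloor>)"
  have lev: "2 ^ lev A \<le> ?n A" "?n A \<le> 2 ^ Suc (lev A)" for A
  proof -
    have n: "1 \<le> ?n A" by (rule beurling_int_ge_1[OF p])
    hence l: "real (lev A) = of_int \<lfloor>log 2 (?n A)\<rfloor>" by (simp add: lev_def)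
    have "2 powr real (lev A) \<le> 2 powr log 2 (?n A)" unfolding l by simp
    thus "2 ^ lev A \<le> ?n A" using n by (simp add: powr_realpow)
    have "2 powr log 2 (?n A) \<le> 2 powr real (Suc (lev A))"
      using l by (intro powr_mono) (simp_all, linarith)
    thus "?n A \<le> 2 ^ Suc (lev A)" using n by (simp add: powr_realpow del: of_nat_Suc power_Suc)
  qed
  define q where "q = 2 powr (1 - \<sigma>)"
  have q: "0 \<le> q" "q < 1" using \<sigma> by (auto simp: q_def powr_less_one)
  show ?thesis
  proof (rule nonneg_bdd_above_summable_on, simp, rule bdd_aboveI2)
    fix F :: "nat multiset set" assume "F \<in> {F. F \<subseteq> UNIV \<and> finite F}"
    hence F: "finite F" by simp
    have "(\<Sum>A\<in>F. ?n A powr (-\<sigma>)) = (\<Sum>l\<in>lev ` F. \<Sum>A | A \<in> F \<and> lev A = l. ?n A powr (-\<sigma>))"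
      by (rule sum.image_gen[OF F])
    also have "\<dots> \<le> (\<Sum>l\<in>lev ` F. 2 * C * q ^ l)"
    proof (rule sum_mono)
      fix l
      have "(\<Sum>A | A \<in> F \<and> lev A = l. ?n A powr (-\<sigma>)) \<le> (\<Sum>A | A \<in> F \<and> lev A = l. (2 ^ l) powr (-\<sigma>))"
        by (intro sum_mono powr_mono2') (use lev(1) \<sigma> in auto)
      also have "\<dots> = real (card {A \<in> F. lev A = l}) * (2 ^ l) powr (-\<sigma>)" by simp
      also have "\<dots> \<le> beurling_N p (2 ^ Suc l) * (2 ^ l) powr (-\<sigma>)"
        unfolding beurling_N_def
        by (intro mult_right_mono of_nat_mono card_mono finite_beurling_int_le[OF p])
           (use lev(2) in \<open>auto simp del: power_Suc\<close>)
      also have "\<dots> \<le> C * 2 ^ Suc l * (2 ^ l) powr (-\<sigma>)"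
        by (intro mult_right_mono C) (auto simp: one_le_power simp del: power_Suc)
      also have "\<dots> = 2 * C * (2 powr real l * 2 powr (- \<sigma> * real l))"
        by (simp add: powr_powr mult.commute flip: powr_realpow)
      also have "2 powr real l * 2 powr (- \<sigma> * real l) = 2 powr ((1 - \<sigma>) * real l)"
        by (simp add: algebra_simps flip: powr_add)
      also have "\<dots> = q ^ l" by (simp add: q_def powr_powr flip: powr_realpow)
      finally show "(\<Sum>A | A \<in> F \<and> lev A = l. ?n A powr (-\<sigma>)) \<le> 2 * C * q ^ l" .
    qed
    also have "\<dots> = 2 * C * (\<Sum>l\<in>lev ` F. q ^ l)" by (simp add: sum_distrib_left)
    also have "\<dots> \<le> 2 * C * (\<Sum>l. q ^ l)"
      by (intro mult_left_mono sum_le_suminf summable_geometric) (use F q in \<open>auto simp: C_def\<close>)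
    finally show "(\<Sum>A\<in>F. ?n A powr (-\<sigma>)) \<le> 2 * C * (\<Sum>l. q ^ l)" .
  qed
qed

lemma beurling_zeta_identities:
  assumes p: "beurling_primes p" and N: "beurling_N p \<sim>[at_top] (\<lambda>x. a * x)" and s: "1 < Re s"
  shows "beurling_zeta p s =
           exp (LINT x:{1..}|interval_measure (beurling_Pi p). complex_of_real x powr (-s))"
    and "(\<Sum>\<^sub>\<infinity>A. of_real (beurling_mu A) * complex_of_real (beurling_int p A) powr (-s)) =
           1 / beurling_zeta p s"
proof -
  note sm = beurling_int_powr_summable[OF p N s]
  show eq: "beurling_zeta p s =
      exp (LINT x:{1..}|interval_measure (beurling_Pi p). complex_of_real x powr (-s))"
    by (rule beurling_zeta_eq_exp[OF p _ sm]) (use s in simp)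
  hence "beurling_zeta p s \<noteq> 0" by simp
  thus "(\<Sum>\<^sub>\<infinity>A. of_real (beurling_mu A) * complex_of_real (beurling_int p A) powr (-s)) =
      1 / beurling_zeta p s"
    using beurling_zeta_mu[OF p sm] by (simp add: eq_divide_eq)
qed

end

theory Submission
  imports Defs "HOL-Probability.Sinc_Integral"
begin

text \<open>
  Put \<open>f(u) = m(e\<^sup>u)\<close>. Its Laplace transform is \<open>G(s) = 1 / (s \<zeta>(1 + s))\<close>, and the hypothesis says that
  \<open>G(\<epsilon> + it)\<close> is, locally in \<open>t\<close> and uniformly in \<open>\<epsilon>\<close>, dominated by a constant multiple of
  \<open>\<Prod> |t - t\<^sub>n| powr (-\<beta>\<^sub>n)\<close>, which is locally integrable because every \<open>\<beta>\<^sub>n < 1\<close>.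
  No boundary value of \<open>G\<close> need exist, but the domination alone yields a Riemann--Lebesgue lemma, so
  the convolution of \<open>f\<close> with a kernel whose Fourier transform has compact support tends to \<open>0\<close>
  along every arithmetic progression. Since \<open>N(x) \<sim> ax\<close> makes \<open>f\<close> slowly oscillating, with oscillation
  growing at most linearly, the kernel can be concentrated and removed, and \<open>f \<rightarrow> 0\<close>.
\<close>

subsection \<open>The cubic B-spline and the Jackson kernel\<close>

text \<open>In the hypothesis the term in \<open>log |s - 1|\<close> cancels the factor
  \<open>1/s\<close> of the Laplace transform, so no singularity arises at \<open>t = 0\<close> and
  only those at the t_n remain. The resulting bound is uniform in \<epsilon> but says nothing about
  convergence as \<epsilon> tends to 0. Convergence is available only on the other side of the
  transform: for each fixed shift \<open>h\<close> the smoothed values of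
  \<open>f u * exp (- \<epsilon> * u)\<close> converge. One \<epsilon> thus serves only finitely
  many \<open>h\<close> at a time, and the Riemann--Lebesgue step becomes a count of the
  \<open>h\<close> at which the limit is large. The count rests on orthogonality of exponentials,
  hence the sampling of \<open>h\<close> on a grid, made as fine as the slow oscillation of
  \<open>f\<close> demands. The Fejer kernel would not do for the smoothing: it decays like
  \<open>1/v^2\<close>, too slowly against a function known only to grow at most linearly. Its
  square is integrable against such growth and still nonnegative.\<close>

definition bspline :: "real \<Rightarrow> real" where
  "bspline t = (if \<bar>t\<bar> \<le> 1 then 4 - 6 * t\<^sup>2 + 3 * \<bar>t\<bar> ^ 3 else if \<bar>t\<bar> \<le> 2 then (2 - \<bar>t\<bar>) ^ 3 else 0)"

text \<open>\<open>bspline\<close> is six times the cardinal cubic B-spline, the fourfold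
  convolution of the indicator of [-1/2, 1/2]; the factor 6 makes its coefficients integers. Its
  Fourier transform is therefore 6 times the fourth power of \<open>sin (v/2) / (v/2)\<close>, which
  is this formula, with the limit value at 0.\<close>

definition jackson :: "real \<Rightarrow> real" where
  "jackson v = (if v = 0 then 6 else 24 * (1 - cos v)\<^sup>2 / v ^ 4)"

lemma bspline_measurable [measurable]: "bspline \<in> borel_measurable borel"
  unfolding bspline_def[abs_def] by measurable

lemma bspline_uminus: "bspline (- t) = bspline t"
  by (simp add: bspline_def)

lemma bspline_eq_0: "2 < \<bar>t\<bar> \<Longrightarrow> bspline t = 0"
  by (simp add: bspline_def)

text \<open>On the middle piece 13 = 4 + 6 + 3, term by term.\<close>

lemma abs_bspline_le: "\<bar>bspline t\<bar> \<le> 13"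
proof -
  consider "\<bar>t\<bar> \<le> 1" | "1 < \<bar>t\<bar>" "\<bar>t\<bar> \<le> 2" | "2 < \<bar>t\<bar>" by linarith
  thus ?thesis
  proof cases
    case 1
    have "t\<^sup>2 \<le> 1" "\<bar>t\<bar> ^ 3 \<le> 1" using 1 by (auto simp: abs_square_le_1 power_le_one)
    thus ?thesis using 1 by (simp add: bspline_def) (smt (verit) zero_le_power2 zero_le_power abs_ge_zero)
  next
    case 2
    have "(2 - \<bar>t\<bar>) ^ 3 \<le> 1" "0 \<le> (2 - \<bar>t\<bar>) ^ 3" using 2 by (auto intro!: power_le_one)
    thus ?thesis using 2 by (simp add: bspline_def)
  qed (simp add: bspline_def)
qed

lemma integrable_bspline: "integrable lborel bspline"
proof (rule Bochner_Integration.integrable_bound[where f = "\<lambda>t. 13 * indicat_real {-2..2} t"])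
  show "AE t in lborel. norm (bspline t) \<le> norm (13 * indicat_real {-2..2} t)"
    using abs_bspline_le bspline_eq_0 by (intro AE_I2) (auto simp: indicator_def)
qed auto

text \<open>\<open>F\<close> is the outcome of integrating by parts until the cubic is
  differentiated away: its successive derivatives appear over increasing powers of
  \<open>v\<close>.\<close>

lemma has_integral_cubic_cos:
  fixes b c d e v x y :: real
  assumes "x \<le> y" "v \<noteq> 0"
  defines "F \<equiv> \<lambda>t. (b + c * t + d * t\<^sup>2 + e * t ^ 3) * sin (t * v) / v
    + (c + 2 * d * t + 3 * e * t\<^sup>2) * cos (t * v) / v\<^sup>2
    - (2 * d + 6 * e * t) * sin (t * v) / v ^ 3 - 6 * e * cos (t * v) / v ^ 4"
  shows "((\<lambda>t. (b + c * t + d * t\<^sup>2 + e * t ^ 3) * cos (t * v)) has_integral F y - F x) {x..y}"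
proof (rule fundamental_theorem_of_calculus[OF assms(1)])
  fix t assume "t \<in> {x..y}"
  have "(F has_real_derivative (b + c * t + d * t\<^sup>2 + e * t ^ 3) * cos (t * v)) (at t within {x..y})"
    unfolding F_def
    by (rule derivative_eq_intros refl | use assms(2) in force)+
       (use assms(2) in \<open>simp add: field_simps power2_eq_square power3_eq_cube power4_eq_xxxx\<close>)
  thus "(F has_vector_derivative (b + c * t + d * t\<^sup>2 + e * t ^ 3) * cos (t * v)) (at t within {x..y})"
    by (simp add: has_real_derivative_iff_has_vector_derivative)
qed

lemma has_integral_cubic:
  fixes b c d e x y :: real
  assumes "x \<le> y"
  defines "F \<equiv> \<lambda>t. b * t + c * t\<^sup>2 / 2 + d * t ^ 3 / 3 + e * t ^ 4 / 4"
  shows "((\<lambda>t. b + c * t + d * t\<^sup>2 + e * t ^ 3) has_integral F y - F x) {x..y}"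
proof (rule fundamental_theorem_of_calculus[OF assms(1)])
  fix t assume "t \<in> {x..y}"
  have "(F has_real_derivative b + c * t + d * t\<^sup>2 + e * t ^ 3) (at t within {x..y})"
    unfolding F_def
    by (rule derivative_eq_intros refl | force)+
  thus "(F has_vector_derivative b + c * t + d * t\<^sup>2 + e * t ^ 3) (at t within {x..y})"
    by (simp add: has_real_derivative_iff_has_vector_derivative)
qed

text \<open>The coefficients 0, 1 and -1 are written out so that each piece matches the cubic
  \<open>b + c * t + d * t\<^sup>2 + e * t ^ 3\<close> of the two integration lemmas. Neighbouring
  pieces agree at the knots, so closed intervals can be used.\<close>

lemma bspline_pieces:
  shows "t \<in> {-2..-1} \<Longrightarrow> bspline t = 8 + 12 * t + 6 * t\<^sup>2 + 1 * t ^ 3"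
    and "t \<in> {-1..0} \<Longrightarrow> bspline t = 4 + 0 * t + (-6) * t\<^sup>2 + (-3) * t ^ 3"
    and "t \<in> {0..1} \<Longrightarrow> bspline t = 4 + 0 * t + (-6) * t\<^sup>2 + 3 * t ^ 3"
    and "t \<in> {1..2} \<Longrightarrow> bspline t = 8 + (-12) * t + 6 * t\<^sup>2 + (-1) * t ^ 3"
proof -
  assume t: "t \<in> {-2..-1}"
  show "bspline t = 8 + 12 * t + 6 * t\<^sup>2 + 1 * t ^ 3"
  proof (cases "t = -1")
    case False
    hence "bspline t = (2 + t) ^ 3" using t by (simp add: bspline_def)
    thus ?thesis by (simp add: power2_eq_square power3_eq_cube algebra_simps)
  qed (simp add: bspline_def)
next
  assume t: "t \<in> {1..2}"
  show "bspline t = 8 + (-12) * t + 6 * t\<^sup>2 + (-1) * t ^ 3"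
  proof (cases "t = 1")
    case False
    hence "bspline t = (2 - t) ^ 3" using t by (simp add: bspline_def)
    thus ?thesis by (simp add: power2_eq_square power3_eq_cube algebra_simps)
  qed (simp add: bspline_def)
qed (auto simp: bspline_def power3_eq_cube)

lemma has_integral_bspline_cos:
  "((\<lambda>t. bspline t * cos (t * v)) has_integral jackson v) {-2..2}"
proof (cases "v = 0")
  case True
  have 1: "(bspline has_integral 1/4) {-2..-1}"
    by (rule has_integral_eq[OF bspline_pieces(1)[symmetric]], assumption)
       (rule has_integral_eq_rhs, rule has_integral_cubic, auto)
  have 2: "(bspline has_integral 11/4) {-1..0}"
    by (rule has_integral_eq[OF bspline_pieces(2)[symmetric]], assumption)
       (rule has_integral_eq_rhs, rule has_integral_cubic, auto)
  have 3: "(bspline has_integral 11/4) {0..1}"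
    by (rule has_integral_eq[OF bspline_pieces(3)[symmetric]], assumption)
       (rule has_integral_eq_rhs, rule has_integral_cubic, auto)
  have 4: "(bspline has_integral 1/4) {1..2}"
    by (rule has_integral_eq[OF bspline_pieces(4)[symmetric]], assumption)
       (rule has_integral_eq_rhs, rule has_integral_cubic, auto)
  have "(bspline has_integral (1/4 + 11/4)) {-2..0}"
    by (rule has_integral_combine[OF _ _ 1 2]) auto
  moreover have "(bspline has_integral (11/4 + 1/4)) {0..2}"
    by (rule has_integral_combine[OF _ _ 3 4]) auto
  ultimately have "(bspline has_integral ((1/4 + 11/4) + (11/4 + 1/4))) {-2..2}"
    by (rule has_integral_combine[rotated 2]) auto
  thus ?thesis using True by (simp add: jackson_def)
next
  case False
  let ?f = "\<lambda>t. bspline t * cos (t * v)"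
  have piece: "(?f has_integral I) {x..y}"
    if "\<And>t. t \<in> {x..y} \<Longrightarrow> bspline t = q t" "((\<lambda>t. q t * cos (t * v)) has_integral I) {x..y}"
    for x y I and q :: "real \<Rightarrow> real"
    by (rule has_integral_eq[OF _ that(2)]) (simp add: that(1))
  note I = has_integral_cubic_cos[OF _ False]
  have double: "cos (2 * v) = 2 * (cos v)\<^sup>2 - 1" "sin (2 * v) = 2 * sin v * cos v"
    "cos (v * 2) = 2 * (cos v)\<^sup>2 - 1" "sin (v * 2) = 2 * sin v * cos v"
    by (simp_all add: cos_double_cos sin_double mult.commute[of v 2])
  note J = has_integral_combine[where c = 0, OF _ _
         has_integral_combine[where c = "-1", OF _ _ piece[OF bspline_pieces(1) I] piece[OF bspline_pieces(2) I]]
         has_integral_combine[where c = 1, OF _ _ piece[OF bspline_pieces(3) I] piece[OF bspline_pieces(4) I]]]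
  \<comment> \<open>The spline is twice continuously differentiable, so the boundary terms over
    \<open>v\<close>, \<open>v^2\<close> and \<open>v^3\<close> cancel. The jumps of the third
    derivative leave \<open>(12 cos 2v - 48 cos v + 36) / v^4\<close>, which the double angle
    formula turns into the kernel.\<close>
  show ?thesis
    by (rule has_integral_eq_rhs, rule J)
       (use False in \<open>simp_all add: jackson_def double power2_diff algebra_simps add_divide_distrib diff_divide_distrib\<close>)
qed

text \<open>The cubic B-spline and its Fourier transform, the Jackson kernel, serve as the smoothing pair:
  the spline has compact support, while the kernel is nonnegative, so that its mass is nonzero,
  and decays fast enough to integrate linearly growing functions.\<close>

lemma integral_bspline_cis:
  "(LINT t|lborel. of_real (bspline t) * cis (t * v)) = complex_of_real (jackson v)"
proof -
  have bd: "integrable lborel (\<lambda>t. bspline t * g t)" if [measurable]: "g \<in> borel_measurable borel"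
    and "\<And>t. \<bar>g t\<bar> \<le> 1" for g
    by (rule Bochner_Integration.integrable_bound[OF integrable_bspline])
       (use that(2) in \<open>auto simp: abs_mult intro!: mult_left_le\<close>)
  have c: "integrable lborel (\<lambda>t. bspline t * cos (t * v))"
    and s: "integrable lborel (\<lambda>t. bspline t * sin (t * v))"
    by (auto intro!: bd)
  have "(LINT t|lborel. bspline t * cos (t * v)) = integral UNIV (\<lambda>t. bspline t * cos (t * v))"
    by (rule integral_lborel[OF c, symmetric])
  also have "\<dots> = jackson v"
  proof (rule integral_unique)
    show "((\<lambda>t. bspline t * cos (t * v)) has_integral jackson v) UNIV"
      by (rule has_integral_on_superset[OF has_integral_bspline_cos]) (auto simp: bspline_def)
  qed
  finally have C: "(LINT t|lborel. bspline t * cos (t * v)) = jackson v" .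
  have "(LINT t|lborel. bspline t * sin (t * v)) = (LINT t|lborel. - (bspline t * sin (t * v)))"
    by (subst lborel_integral_real_affine[where c = "-1" and t = 0]) (auto simp: bspline_uminus)
  hence S: "(LINT t|lborel. bspline t * sin (t * v)) = 0" by simp
  have "(LINT t|lborel. of_real (bspline t) * cis (t * v)) =
        (LINT t|lborel. of_real (bspline t * cos (t * v)) + \<i> * of_real (bspline t * sin (t * v)))"
    by (intro Bochner_Integration.integral_cong refl) (simp add: complex_eq_iff)
  also have "\<dots> = of_real (jackson v)"
    by (subst Bochner_Integration.integral_add)
       (auto intro!: c s simp: C S simp del: of_real_mult)
  finally show ?thesis .
qed

section \<open>Decay, integrability and positive mass of the Jackson kernel\<close>

lemma jackson_measurable [measurable]: "jackson \<in> borel_measurable borel"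
  unfolding jackson_def[abs_def] by measurable

lemma jackson_nonneg: "0 \<le> jackson v"
  by (simp add: jackson_def)

text \<open>The weight \<open>1 + \<bar>v\<bar>\<close> anticipates the linear oscillation bound on
  \<open>f\<close>. Near 0 the kernel is at most 6, because
  \<open>1 - cos v \<le> v\<^sup>2 / 2\<close>. Far out the weighted kernel is at most
  \<open>192 / v^2\<close>, and \<open>1 + v\<^sup>2 \<le> 2 * v\<^sup>2\<close> turns this into the
  constant 384.\<close>

lemma jackson_le: "(1 + \<bar>v\<bar>) * jackson v \<le> 384 * inverse (1 + v\<^sup>2)"
proof (cases "\<bar>v\<bar> \<le> 1")
  case True
  have "jackson v \<le> 6"
  proof (cases "v = 0")
    case False
    have "1 - cos v \<le> v\<^sup>2 / 2"
    proof -
      have "1 - cos v = 2 * \<bar>sin (v / 2)\<bar>\<^sup>2" using cos_double_sin[of "v / 2"] by simp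
      also have "\<dots> \<le> 2 * \<bar>v / 2\<bar>\<^sup>2" using abs_sin_x_le_abs_x[of "v / 2"] by (intro mult_left_mono power_mono) auto
      finally show ?thesis by (simp add: power2_eq_square)
    qed
    hence "(1 - cos v)\<^sup>2 \<le> (v\<^sup>2 / 2)\<^sup>2" by (intro power_mono) auto
    also have "\<dots> = v ^ 4 / 4" by (simp add: power2_eq_square power4_eq_xxxx)
    finally show ?thesis using False by (simp add: jackson_def field_simps)
  qed (simp add: jackson_def)
  hence "(1 + \<bar>v\<bar>) * jackson v \<le> 2 * 6" using True jackson_nonneg by (intro mult_mono) auto
  also have "12 * (1 + v\<^sup>2) \<le> 384" using True abs_square_le_1[of v] by simp
  hence "2 * 6 \<le> 384 * inverse (1 + v\<^sup>2)"
    by (simp add: field_simps add_pos_nonneg)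
  finally show ?thesis .
next
  case False
  have v: "1 < \<bar>v\<bar>" "v \<noteq> 0" using False by auto
  have "(1 - cos v)\<^sup>2 \<le> 2\<^sup>2" using cos_ge_minus_one[of v] by (intro power_mono) auto
  hence "jackson v \<le> 96 / v ^ 4" using v(2) by (simp add: jackson_def divide_right_mono)
  hence "(1 + \<bar>v\<bar>) * jackson v \<le> (2 * \<bar>v\<bar>) * (96 / v ^ 4)"
    using v jackson_nonneg by (intro mult_mono) auto
  also have "\<dots> = 192 / \<bar>v\<bar> ^ 3"
    using v by (auto simp: abs_if power3_eq_cube power4_eq_xxxx field_simps)
  also have "\<dots> \<le> 192 / \<bar>v\<bar>\<^sup>2"
    using v by (intro divide_left_mono power_increasing) auto
  also have "\<dots> \<le> 384 * inverse (1 + v\<^sup>2)"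
  proof -
    have "1 \<le> v\<^sup>2" using one_le_power[of "\<bar>v\<bar>" 2] v by simp
    thus ?thesis using v by (simp add: field_simps add_pos_nonneg)
  qed
  finally show ?thesis .
qed

lemma integrable_jackson_weighted: "integrable lborel (\<lambda>v. (1 + \<bar>v\<bar>) * jackson v)"
proof (rule Bochner_Integration.integrable_bound)
  show "integrable lborel (\<lambda>v::real. 384 * inverse (1 + v\<^sup>2))"
    using integrable_inverse_1_plus_square by (simp add: set_integrable_def)
  show "AE v in lborel. norm ((1 + \<bar>v\<bar>) * jackson v) \<le> norm (384 * inverse (1 + v\<^sup>2))"
    using jackson_le jackson_nonneg by (intro AE_I2) (auto simp: abs_mult)
qed auto

lemma integrable_jackson: "integrable lborel jackson"
proof (rule Bochner_Integration.integrable_bound[OF integrable_jackson_weighted])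
  have "jackson v \<le> (1 + \<bar>v\<bar>) * jackson v" for v
    using jackson_nonneg[of v] by (simp add: distrib_right)
  thus "AE v in lborel. norm (jackson v) \<le> norm ((1 + \<bar>v\<bar>) * jackson v)"
    using jackson_nonneg by (intro AE_I2) (auto simp: abs_mult)
qed auto

text \<open>The total mass is later divided out. A nonnegative function of integral 0 vanishes
  almost everywhere, but \<open>cos v < 1\<close> on the interval (1, 2), which has positive
  measure.\<close>

lemma integral_jackson_pos: "0 < (LINT v|lborel. jackson v)"
proof (rule ccontr)
  assume "\<not> ?thesis"
  moreover have "0 \<le> (LINT v|lborel. jackson v)"
    using jackson_nonneg by (intro integral_nonneg_AE) auto
  ultimately have "(LINT v|lborel. jackson v) = 0" by simp
  hence "AE v in lborel. jackson v = 0"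
    using integral_nonneg_eq_0_iff_AE[OF integrable_jackson] jackson_nonneg by simp
  hence "AE v in lborel. \<not> (1 < v \<and> v < (2::real))"
  proof eventually_elim
    case (elim v)
    have "cos v < 1" if "1 < v" "v < 2"
      using cos_monotone_0_pi[of 0 v] that pi_gt3 by simp
    thus ?case using elim by (auto simp: jackson_def split: if_splits)
  qed
  hence "{1<..<2::real} \<in> null_sets lborel"
    by (subst AE_iff_null_sets) (auto elim: eventually_mono)
  thus False by (simp add: null_sets_def)
qed

subsection \<open>A Riemann--Lebesgue lemma without limits\<close>

lemma cis_measurable [measurable]: "cis \<in> borel_measurable borel"
  by (intro borel_measurable_continuous_onI continuous_intros)

lemma integral_cis_period:
  fixes \<Lambda> :: real and m :: int
  assumes "0 < \<Lambda>"
  shows "(LINT t:{-\<Lambda>..\<Lambda>}|lborel. cis (m * pi / \<Lambda> * t)) = (if m = 0 then of_real (2 * \<Lambda>) else 0)"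
proof (cases "m = 0")
  case True
  thus ?thesis using assms by (simp add: set_lebesgue_integral_def scaleR_conv_of_real)
next
  case False
  define w where "w = m * pi / \<Lambda>"
  have w: "w \<noteq> 0" using False assms by (simp add: w_def)
  let ?F = "\<lambda>t. cis (w * t) / (\<i> * of_real w)"
  have "(?F has_vector_derivative cis (w * t)) (at t within A)" for t A
    using w unfolding has_vector_derivative_def
    by (auto intro!: derivative_eq_intros simp: fun_eq_iff scaleR_conv_of_real) (simp add: complex_eq_iff)
  hence "(LINT t|lborel. indicator {-\<Lambda>..\<Lambda>} t *\<^sub>R cis (w * t)) = ?F \<Lambda> - ?F (-\<Lambda>)"
    using assms by (intro integral_FTC_atLeastAtMost) (auto intro!: continuous_intros)
  also have "cis (w * \<Lambda>) = cis (w * (-\<Lambda>))"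
  proof -
    have "cis (w * \<Lambda>) = cis (w * (-\<Lambda>) + 2 * pi * of_int m)" using assms by (simp add: w_def mult.commute)
    also have "\<dots> = cis (w * (-\<Lambda>)) * cis (2 * pi * of_int m)" by (simp only: cis_mult)
    also have "cis (2 * pi * of_int m) = 1"
      using cis_multiple_2pi[of "of_int m"] by (simp add: mult_ac)
    finally show ?thesis by simp
  qed
  finally show ?thesis using False by (simp add: set_lebesgue_integral_def w_def)
qed

lemma integrable_le_indicator:
  fixes g :: "real \<Rightarrow> 'b::{banach,second_countable_topology}" and a b C :: real
  assumes [measurable]: "g \<in> borel_measurable borel" and le: "\<And>t. norm (g t) \<le> C * indicator {a..b} t"
  shows "integrable lborel g"
proof (rule Bochner_Integration.integrable_bound)
  show "integrable lborel (\<lambda>t. C * indicator {a..b} t)"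
    by (cases "a \<le> b") auto
qed (auto intro: order_trans[OF le abs_ge_self])

text \<open>Bessel's inequality on [-\<Lambda>, \<Lambda>] by duality. The test polynomial
  \<open>S\<close>, whose coefficients are the conjugates of those of \<open>H\<close>, satisfies
  \<open>LINT H S = Q\<close> and \<open>LINT |S|^2 = 2 * \<Lambda> * Q\<close>, where
  \<open>Q\<close> is the sum to be bounded. The bound does not depend on \<open>F\<close>, which is
  what makes counting possible.\<close>

lemma bessel_bounded:
  fixes H :: "real \<Rightarrow> complex" and \<Lambda> B :: real and F :: "nat set"
  assumes \<Lambda>: "0 < \<Lambda>" and [measurable]: "H \<in> borel_measurable borel"
    and B: "\<And>t. norm (H t) \<le> B" and supp: "\<And>t. \<Lambda> < \<bar>t\<bar> \<Longrightarrow> H t = 0" and F: "finite F"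
  shows "(\<Sum>k\<in>F. (norm (LINT t|lborel. H t * cis (k * pi / \<Lambda> * t)))\<^sup>2) \<le> (2 * \<Lambda> * B)\<^sup>2"
proof -
  define e where "e = (\<lambda>(k::nat) t::real. cis (k * pi / \<Lambda> * t))"
  define a where "a = (\<lambda>k. LINT t|lborel. H t * e k t)"
  define S where "S = (\<lambda>t. \<Sum>k\<in>F. cnj (a k) * e k t)"
  define Q where "Q = (\<Sum>k\<in>F. (norm (a k))\<^sup>2)"
  let ?I = "indicat_real {-\<Lambda>..\<Lambda>}"
  have [measurable]: "e k \<in> borel_measurable borel" for k unfolding e_def by measurable
  have [measurable]: "S \<in> borel_measurable borel" unfolding S_def by measurable
  have [measurable]: "(\<lambda>t. cnj (e k t)) \<in> borel_measurable borel" for k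
    unfolding e_def cis_cnj by measurable
  have ne: "norm (e k t) = 1" for k t by (simp add: e_def)
  note bd = integrable_le_indicator[where a = "-\<Lambda>" and b = \<Lambda>]
  have HI: "norm (H t) \<le> B * ?I t" for t
    using B[of t] supp[of t] by (auto simp: indicator_def)
  have He: "integrable lborel (\<lambda>t. H t * e k t)" for k
    by (rule bd[where C = B]) (use HI in \<open>auto simp: norm_mult ne\<close>)
  have S1: "norm (S t) \<le> (\<Sum>k\<in>F. norm (a k))" for t
    unfolding S_def by (rule order_trans[OF norm_sum]) (simp add: norm_mult ne)
  have iS2: "integrable lborel (\<lambda>t. (norm (S t))\<^sup>2 * ?I t)"
    by (rule bd[where C = "(\<Sum>k\<in>F. norm (a k))\<^sup>2"])
       (use S1 in \<open>auto simp: indicator_def intro!: power_mono\<close>)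
  have iH2: "integrable lborel (\<lambda>t. (norm (H t))\<^sup>2)"
    by (rule bd[where C = "B\<^sup>2"])
       (use B supp in \<open>auto simp: indicator_def intro!: power_mono\<close>)
  have HS: "(LINT t|lborel. H t * S t) = of_real Q"
  proof -
    have "(LINT t|lborel. H t * S t) = (LINT t|lborel. (\<Sum>k\<in>F. cnj (a k) * (H t * e k t)))"
      by (simp add: S_def sum_distrib_left mult_ac)
    also have "\<dots> = (\<Sum>k\<in>F. cnj (a k) * a k)"
      by (subst Bochner_Integration.integral_sum) (auto intro!: He simp: a_def)
    also have "\<dots> = of_real Q"
      by (simp add: Q_def complex_norm_square mult.commute flip: of_real_power)
    finally show ?thesis .
  qed
  have ortho: "(LINT t|lborel. ?I t *\<^sub>R (cnj (a j) * a k * (e j t * cnj (e k t)))) =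
      (if j = k then of_real (2 * \<Lambda> * (norm (a k))\<^sup>2) else 0)" for j k
  proof -
    have "e j t * cnj (e k t) = cis ((int j - int k) * pi / \<Lambda> * t)" for t
      by (simp add: e_def cis_cnj cis_mult algebra_simps diff_divide_distrib)
    hence "(LINT t|lborel. ?I t *\<^sub>R (cnj (a j) * a k * (e j t * cnj (e k t)))) =
        cnj (a j) * a k * (LINT t:{-\<Lambda>..\<Lambda>}|lborel. cis ((int j - int k) * pi / \<Lambda> * t))"
      unfolding set_lebesgue_integral_def by (subst integral_mult_right_zero[symmetric]) (simp add: mult_ac)
    thus ?thesis using integral_cis_period[OF \<Lambda>, of "int j - int k"]
      by (simp add: complex_norm_square mult_ac flip: of_real_power)
  qed
  have S2: "(LINT t|lborel. (norm (S t))\<^sup>2 * ?I t) = 2 * \<Lambda> * Q"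
  proof -
    have "complex_of_real (LINT t|lborel. (norm (S t))\<^sup>2 * ?I t) =
        (LINT t|lborel. of_real ((norm (S t))\<^sup>2 * ?I t))" by (rule integral_complex_of_real[symmetric])
    also have "\<dots> = (LINT t|lborel. (\<Sum>j\<in>F. \<Sum>k\<in>F. ?I t *\<^sub>R (cnj (a j) * a k * (e j t * cnj (e k t)))))"
    proof (intro Bochner_Integration.integral_cong refl)
      fix t
      have "complex_of_real ((norm (S t))\<^sup>2) = S t * cnj (S t)" by (rule complex_norm_square)
      also have "\<dots> = (\<Sum>j\<in>F. \<Sum>k\<in>F. cnj (a j) * a k * (e j t * cnj (e k t)))"
        unfolding S_def cnj_sum sum_product by (intro sum.cong refl) (simp add: mult_ac)
      finally show "complex_of_real ((norm (S t))\<^sup>2 * ?I t) =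
          (\<Sum>j\<in>F. \<Sum>k\<in>F. ?I t *\<^sub>R (cnj (a j) * a k * (e j t * cnj (e k t))))"
        by (simp add: scaleR_sum_right[symmetric] scaleR_conv_of_real mult.commute flip: sum_distrib_left)
    qed
    also have "\<dots> = (\<Sum>j\<in>F. \<Sum>k\<in>F. (LINT t|lborel. ?I t *\<^sub>R (cnj (a j) * a k * (e j t * cnj (e k t)))))"
    proof -
      have "integrable lborel (\<lambda>t. ?I t *\<^sub>R (cnj (a j) * a k * (e j t * cnj (e k t))))" for j k
        by (rule bd[where C = "norm (a j) * norm (a k)"]) (measurable, auto simp: norm_mult ne indicator_def)
      thus ?thesis by (subst Bochner_Integration.integral_sum | intro sum.cong refl
           Bochner_Integration.integrable_sum | assumption)+
    qed
    also have "\<dots> = of_real (2 * \<Lambda> * Q)"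
      unfolding ortho using F by (simp add: Q_def sum_distrib_left)
    finally show ?thesis by (simp only: of_real_eq_iff)
  qed
  have "Q = norm (LINT t|lborel. H t * S t)"
    unfolding HS norm_of_real by (simp add: Q_def sum_nonneg)
  \<comment> \<open>The inequality \<open>x y \<le> \<Lambda> x^2 + y^2 / (4 \<Lambda>)\<close>
    replaces Cauchy-Schwarz. Its weights are chosen so that the \<open>S\<close> part integrates to
    exactly \<open>Q / 2\<close> and can be absorbed on the left.\<close>
  also have "\<dots> \<le> (LINT t|lborel. \<Lambda> * (norm (H t))\<^sup>2 + (norm (S t))\<^sup>2 * ?I t / (4 * \<Lambda>))"
  proof (rule Bochner_Integration.integral_norm_bound_integral)
    show "integrable lborel (\<lambda>t. H t * S t)"
      unfolding S_def sum_distrib_left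
      by (intro Bochner_Integration.integrable_sum) (subst mult.left_commute, intro integrable_mult_right He)
    show "integrable lborel (\<lambda>t. \<Lambda> * (norm (H t))\<^sup>2 + (norm (S t))\<^sup>2 * ?I t / (4 * \<Lambda>))"
      using iH2 iS2 by simp
    show "norm (H t * S t) \<le> \<Lambda> * (norm (H t))\<^sup>2 + (norm (S t))\<^sup>2 * ?I t / (4 * \<Lambda>)" for t
    proof (cases "\<Lambda> < \<bar>t\<bar>")
      case False
      have "0 \<le> (2 * \<Lambda> * norm (H t) - norm (S t))\<^sup>2" by simp
      hence "4 * \<Lambda> * (norm (H t) * norm (S t)) \<le> 4 * \<Lambda> * (\<Lambda> * (norm (H t))\<^sup>2) + (norm (S t))\<^sup>2"
        by (simp add: power2_eq_square algebra_simps)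
      thus ?thesis using False \<Lambda> by (simp add: norm_mult indicator_def abs_le_iff not_less field_simps)
    qed (use \<Lambda> supp in simp)
  qed
  also have "\<dots> = \<Lambda> * (LINT t|lborel. (norm (H t))\<^sup>2) + Q / 2"
    using iH2 iS2 S2 \<Lambda> by (simp add: field_simps)
  also have "(LINT t|lborel. (norm (H t))\<^sup>2) \<le> (LINT t|lborel. B\<^sup>2 * ?I t)"
  proof (intro integral_mono iH2)
    show "integrable lborel (\<lambda>t. B\<^sup>2 * ?I t)"
      by (rule bd[where C = "B\<^sup>2"]) auto
    show "(norm (H t))\<^sup>2 \<le> B\<^sup>2 * ?I t" for t
      using B supp by (auto simp: indicator_def intro!: power_mono)
  qed
  hence "\<Lambda> * (LINT t|lborel. (norm (H t))\<^sup>2) + Q / 2 \<le> \<Lambda> * (B\<^sup>2 * (2 * \<Lambda>)) + Q / 2"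
    using \<Lambda> by simp
  finally show ?thesis
    unfolding Q_def a_def e_def by (simp add: power2_eq_square mult_ac)
qed

text \<open>A Riemann--Lebesgue lemma for families without a pointwise limit: a uniform \<open>L\<^sup>1\<close> majorant
  suffices, since off the set where the majorant is large Bessel's inequality bounds, uniformly in
  the family, the number of frequencies at which the transform can be large.\<close>

lemma dominated_riemann_lebesgue:
  fixes G :: "nat \<Rightarrow> real \<Rightarrow> complex" and g :: "real \<Rightarrow> real" and \<Lambda> :: real
  assumes \<Lambda>: "0 < \<Lambda>" and G [measurable]: "\<And>n. G n \<in> borel_measurable borel"
    and g: "integrable lborel g" and dom: "\<And>n. AE t in lborel. norm (G n t) \<le> g t"
    and supp: "\<And>n t. \<Lambda> < \<bar>t\<bar> \<Longrightarrow> G n t = 0"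
    and lim: "\<And>k. (\<lambda>n. LINT t|lborel. G n t * cis (real k * pi / \<Lambda> * t)) \<longlonglongrightarrow> L k"
  shows "L \<longlonglongrightarrow> 0"
proof (rule tendstoI)
  fix \<eta>' :: real assume "0 < \<eta>'"
  \<comment> \<open>One \<eta> is lost by truncation and one is the threshold for Bessel's
    inequality, which gives \<open>2 * \<eta>\<close>; the third makes the final inequality
    strict.\<close>
  define \<eta> where "\<eta> = \<eta>' / 3"
  have \<eta>: "0 < \<eta>" using \<open>0 < \<eta>'\<close> by (simp add: \<eta>_def)
  have gm [measurable]: "g \<in> borel_measurable borel" using g by auto
  have "(\<lambda>M. LINT t|lborel. g t * indicator {t. real M < g t} t) \<longlonglongrightarrow> (LINT t::real|lborel. 0)"
  proof (rule integral_dominated_convergence[where w = "\<lambda>t. norm (g t)"])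
    show "AE t in lborel. (\<lambda>M. g t * indicator {t. real M < g t} t) \<longlonglongrightarrow> 0"
    proof (rule AE_I2, rule tendsto_eventually)
      fix t
      obtain M0 :: nat where "g t \<le> M0" using real_arch_simple by blast
      thus "\<forall>\<^sub>F M in sequentially. g t * indicator {t. real M < g t} t = 0"
        unfolding eventually_sequentially by (intro exI[of _ M0]) (auto simp: indicator_def)
    qed
  qed (use g in \<open>auto simp: indicator_def\<close>)
  hence "eventually (\<lambda>M. (LINT t|lborel. g t * indicator {t. real M < g t} t) < \<eta>) sequentially"
    using \<eta> by (auto dest!: order_tendstoD(2))
  then obtain M :: nat where M: "(LINT t|lborel. g t * indicator {t. real M < g t} t) < \<eta>"
    by (auto simp: eventually_sequentially)
  \<comment> \<open>Truncation at a level \<open>M\<close> common to all \<open>n\<close>: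
    \<open>G n\<close> and \<open>H n\<close> differ only where \<open>norm (G n t)\<close> exceeds
    \<open>M\<close>, hence, almost everywhere, only where \<open>g\<close> does, and the integral
    of \<open>g\<close> there is below \<eta>.\<close>
  define H where "H = (\<lambda>n t. if norm (G n t) \<le> real M then G n t else 0)"
  have [measurable]: "H n \<in> borel_measurable borel" for n unfolding H_def by measurable
  have close: "norm ((LINT t|lborel. G n t * cis (w * t)) - (LINT t|lborel. H n t * cis (w * t))) < \<eta>" for n w
  proof -
    have iG: "integrable lborel (\<lambda>t. G n t * cis (w * t))"
      by (rule Bochner_Integration.integrable_bound[OF g]) (use dom[of n] in \<open>auto simp: norm_mult elim: eventually_mono\<close>)
    have iH: "integrable lborel (\<lambda>t. H n t * cis (w * t))"
      by (rule Bochner_Integration.integrable_bound[OF iG]) (auto simp: norm_mult H_def)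
    have "norm ((LINT t|lborel. G n t * cis (w * t)) - (LINT t|lborel. H n t * cis (w * t))) =
        norm (LINT t|lborel. (G n t - H n t) * cis (w * t))"
      using iG iH by (simp add: left_diff_distrib)
    also have "\<dots> \<le> (LINT t|lborel. norm ((G n t - H n t) * cis (w * t)))"
      by (rule integral_norm_bound)
    also have "\<dots> \<le> (LINT t|lborel. g t * indicator {t. real M < g t} t)"
    proof (rule integral_mono_AE)
      show "integrable lborel (\<lambda>t. norm ((G n t - H n t) * cis (w * t)))"
        using Bochner_Integration.integrable_diff[OF iG iH] by (intro integrable_norm) (simp add: left_diff_distrib)
      show "integrable lborel (\<lambda>t. g t * indicator {t. real M < g t} t)"
        by (rule Bochner_Integration.integrable_bound[OF g]) (auto simp: indicator_def)
      show "AE t in lborel. norm ((G n t - H n t) * cis (w * t)) \<le> g t * indicator {t. real M < g t} t"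
        using dom[of n] by eventually_elim (auto simp: H_def norm_mult indicator_def)
    qed
    finally show ?thesis using M by linarith
  qed
  define C where "C = (2 * \<Lambda> * real M)\<^sup>2 / \<eta>\<^sup>2"
  \<comment> \<open>A finite \<open>F\<close> allows one \<open>n\<close> to be chosen for all its
    frequencies at once, so convergence at each single frequency is enough. The bound
    \<open>C\<close> involves neither \<open>n\<close> nor \<open>F\<close>.\<close>
  have card: "real (card F) \<le> C" if F: "finite F" "F \<subseteq> {k. 2 * \<eta> < norm (L k)}" for F
  proof -
    have "eventually (\<lambda>n. \<forall>k\<in>F. 2 * \<eta> < norm (LINT t|lborel. G n t * cis (real k * pi / \<Lambda> * t))) sequentially"
      using F by (intro eventually_ball_finite ballI order_tendstoD(1)[OF tendsto_norm[OF lim]]) auto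
    then obtain n where n: "\<And>k. k \<in> F \<Longrightarrow> 2 * \<eta> < norm (LINT t|lborel. G n t * cis (real k * pi / \<Lambda> * t))"
      by (auto simp: eventually_sequentially)
    have large: "\<eta> \<le> norm (LINT t|lborel. H n t * cis (real k * pi / \<Lambda> * t))" if "k \<in> F" for k
      using n[OF that] close[of n "real k * pi / \<Lambda>"] norm_triangle_ineq2[of "LINT t|lborel. G n t * cis (real k * pi / \<Lambda> * t)"
        "LINT t|lborel. H n t * cis (real k * pi / \<Lambda> * t)"] by linarith
    have "real (card F) * \<eta>\<^sup>2 \<le> (\<Sum>k\<in>F. (norm (LINT t|lborel. H n t * cis (real k * pi / \<Lambda> * t)))\<^sup>2)"
      using \<eta> large by (intro sum_bounded_below[of F "\<eta>\<^sup>2"] power_mono) auto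
    also have "\<dots> \<le> (2 * \<Lambda> * real M)\<^sup>2"
      by (rule bessel_bounded[OF \<Lambda>]) (use F supp in \<open>auto simp: H_def\<close>)
    finally show ?thesis using \<eta> by (simp add: C_def field_simps)
  qed
  have "finite {k. 2 * \<eta> < norm (L k)}"
  proof (rule ccontr)
    assume "infinite {k. 2 * \<eta> < norm (L k)}"
    then obtain F where "finite F" "card F = nat \<lceil>C\<rceil> + 1" "F \<subseteq> {k. 2 * \<eta> < norm (L k)}"
      by (metis infinite_arbitrarily_large)
    thus False using card[of F] by linarith
  qed
  then obtain k0 where "\<And>k. 2 * \<eta> < norm (L k) \<Longrightarrow> k < k0"
    using finite_nat_bounded by (metis (mono_tags, lifting) lessThan_iff mem_Collect_eq subsetD)
  hence "norm (L k) \<le> 2 * \<eta>" if "k0 \<le> k" for k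
    using that by (meson not_le)
  hence "\<forall>k\<ge>k0. norm (L k) < \<eta>'"
    using \<open>0 < \<eta>'\<close> by (fastforce simp: \<eta>_def)
  thus "eventually (\<lambda>k. dist (L k) 0 < \<eta>') sequentially"
    by (auto simp: eventually_sequentially)
qed

subsection \<open>A Tauberian theorem for slowly oscillating functions\<close>

lemma integrable_linear_growth_exp:
  fixes f :: "real \<Rightarrow> real" and A \<epsilon> :: real
  assumes [measurable]: "f \<in> borel_measurable borel" and neg: "\<And>u. u < 0 \<Longrightarrow> f u = 0"
    and lin: "\<And>u. 0 \<le> u \<Longrightarrow> \<bar>f u\<bar> \<le> A * (2 + u)" and \<epsilon>: "0 < \<epsilon>"
  shows "integrable lborel (\<lambda>u. f u * exp (- \<epsilon> * u))"
proof (rule Bochner_Integration.integrable_bound)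
  \<comment> \<open>Half of the exponent pays for the linear factor: \<open>2 + u\<close> is at most
    \<open>(2 + 2 / \<epsilon>) * (1 + u * \<epsilon> / 2)\<close>, and the second factor is at most
    \<open>exp (u * \<epsilon> / 2)\<close>.\<close>
  define C where "C = A * (2 + 2 / \<epsilon>)"
  have "0 \<le> A * 2" using lin[of 0] by simp
  hence A: "0 \<le> A" by simp
  show "integrable lborel (\<lambda>u. C * (indicator {0<..} u *\<^sub>R exp (- (u * (\<epsilon> / 2)))))"
    using integrable_I0i_exp_mscale[of "\<epsilon> / 2"] \<epsilon> unfolding set_integrable_def by (intro integrable_mult_right) auto
  have "norm (f u * exp (- \<epsilon> * u)) \<le> norm (C * (indicator {0<..} u *\<^sub>R exp (- (u * (\<epsilon> / 2)))))" if "u \<noteq> 0" for u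
  proof (cases "u < 0")
    case False
    hence u: "0 < u" using that by simp
    have "2 + u \<le> (2 + 2 / \<epsilon>) * (1 + u * (\<epsilon> / 2))" using u \<epsilon> by (simp add: field_simps)
    also have "\<dots> \<le> (2 + 2 / \<epsilon>) * exp (u * (\<epsilon> / 2))"
      using \<epsilon> by (intro mult_left_mono exp_ge_add_one_self) auto
    finally have "A * (2 + u) \<le> C * exp (u * (\<epsilon> / 2))"
      using A by (simp add: C_def mult.assoc mult_left_mono)
    hence "\<bar>f u\<bar> \<le> C * exp (u * (\<epsilon> / 2))" using lin[of u] u by simp
    hence "\<bar>f u\<bar> * exp (- \<epsilon> * u) \<le> C * exp (u * (\<epsilon> / 2)) * exp (- \<epsilon> * u)"
      by (intro mult_right_mono) auto
    also have "\<dots> = C * exp (- (u * (\<epsilon> / 2)))" by (simp add: mult.assoc field_simps flip: exp_add)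
    finally show ?thesis using u A \<epsilon> by (simp add: abs_mult C_def)
  qed (use neg in simp)
  thus "AE u in lborel. norm (f u * exp (- \<epsilon> * u)) \<le> norm (C * (indicator {0<..} u *\<^sub>R exp (- (u * (\<epsilon> / 2)))))"
    using AE_lborel_singleton[of "0::real"] by (auto elim: eventually_mono)
qed measurable

text \<open>Multiplying the transform of \<open>F\<close> by the dilated spline, supported in
  [-2\<rho>, 2\<rho>], convolves \<open>F\<close> with a kernel concentrated at scale
  \<open>1 / \<rho>\<close>. Fubini exchanges the integrals, and the factor \<rho> from dilating the
  spline cancels under the substitution \<open>u = h - v / \<rho>\<close>.\<close>

lemma integral_bspline_laplace:
  fixes F :: "real \<Rightarrow> real" and \<rho> h :: real
  assumes F: "integrable lborel F" and \<rho>: "0 < \<rho>"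
  shows "(LINT t|lborel. of_real (bspline (t / \<rho>)) * (LINT u|lborel. of_real (F u) * cis (- (t * u))) * cis (h * t)) =
    complex_of_real (LINT v|lborel. F (h - v / \<rho>) * jackson v)"
proof -
  have [measurable]: "F \<in> borel_measurable borel" using F by auto
  have b: "integrable lborel (\<lambda>t. bspline (t / \<rho>))"
    using lborel_integrable_real_affine[OF integrable_bspline, of "1 / \<rho>" 0] \<rho> by simp
  have int: "integrable (lborel \<Otimes>\<^sub>M lborel)
      (\<lambda>(t, u). complex_of_real (bspline (t / \<rho>)) * (of_real (F u) * cis (- (t * u))) * cis (h * t))"
  proof (rule Bochner_Integration.integrable_bound)
    show "integrable (lborel \<Otimes>\<^sub>M lborel) (\<lambda>(t, u). bspline (t / \<rho>) * F u)"
    proof (rule lborel_pair.Fubini_integrable)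
      show "integrable lborel (\<lambda>t. LINT u|lborel. norm (case (t, u) of (t, u) \<Rightarrow> bspline (t / \<rho>) * F u))"
        using integrable_norm[OF b] by (auto simp: abs_mult intro!: integrable_mult_left)
    qed (use F in \<open>auto intro!: AE_I2\<close>)
  qed (auto simp: norm_mult)
  have inner: "(LINT t|lborel. of_real (bspline (t / \<rho>)) * (of_real (F u) * cis (- (t * u))) * cis (h * t)) =
      complex_of_real (\<rho> * F u * jackson (\<rho> * (h - u)))" for u
  proof -
    have "(LINT t|lborel. of_real (bspline (t / \<rho>)) * (of_real (F u) * cis (- (t * u))) * cis (h * t)) =
      of_real (F u) * (LINT t|lborel. of_real (bspline (t / \<rho>)) * cis (t * (h - u)))"
      by (subst integral_mult_right_zero[symmetric], intro Bochner_Integration.integral_cong refl)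
         (simp add: mult_ac cis_mult right_diff_distrib)
    also have "(LINT t|lborel. of_real (bspline (t / \<rho>)) * cis (t * (h - u))) =
        \<rho> *\<^sub>R (LINT t|lborel. of_real (bspline t) * cis (t * (\<rho> * (h - u))))"
      by (subst lborel_integral_real_affine[where c = \<rho> and t = 0]) (use \<rho> in \<open>auto simp: mult_ac\<close>)
    finally show ?thesis by (simp add: integral_bspline_cis scaleR_conv_of_real)
  qed
  have "(LINT t|lborel. of_real (bspline (t / \<rho>)) * (LINT u|lborel. of_real (F u) * cis (- (t * u))) * cis (h * t)) =
      (LINT t|lborel. LINT u|lborel. of_real (bspline (t / \<rho>)) * (of_real (F u) * cis (- (t * u))) * cis (h * t))"
    by simp
  also have "\<dots> = (LINT u|lborel. LINT t|lborel. of_real (bspline (t / \<rho>)) * (of_real (F u) * cis (- (t * u))) * cis (h * t))"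
    by (rule lborel_pair.Fubini_integral[OF int, symmetric])
  also have "\<dots> = complex_of_real (LINT u|lborel. \<rho> * F u * jackson (\<rho> * (h - u)))"
    unfolding inner by (rule integral_complex_of_real)
  also have "(LINT u|lborel. \<rho> * F u * jackson (\<rho> * (h - u))) = (LINT v|lborel. F (h - v / \<rho>) * jackson v)"
    by (subst lborel_integral_real_affine[where c = "- (1 / \<rho>)" and t = h])
       (use \<rho> in \<open>auto simp: field_simps simp flip: integral_mult_right_zero\<close>)
  finally show ?thesis .
qed

text \<open>The smoothed values \<open>L h\<close> tend to 0 along a grid. Near \<open>h\<close>
  slow oscillation, and far from \<open>h\<close> the linear bound \<open>lin\<close>, identify
  \<open>L h\<close> with \<open>c * f h\<close> up to a small error; slow oscillation then passes
  from the grid to all \<open>u\<close>. The majorant is asked for almost everywhere only, because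
  of its singular points.\<close>

lemma tauberian_slowly_oscillating:
  fixes f :: "real \<Rightarrow> real" and A :: real
  assumes fm [measurable]: "f \<in> borel_measurable borel" and neg: "\<And>u. u < 0 \<Longrightarrow> f u = 0"
    and lin: "\<And>h u. 0 \<le> h \<Longrightarrow> \<bar>f h - f u\<bar> \<le> A * (1 + \<bar>h - u\<bar>)"
    and slow: "\<And>e. 0 < e \<Longrightarrow> \<exists>\<delta>>0. \<exists>U. \<forall>u v. U \<le> u \<and> u \<le> v \<and> v \<le> u + \<delta> \<longrightarrow> \<bar>f v - f u\<bar> \<le> e"
    and dom: "\<And>T. 0 < T \<Longrightarrow> \<exists>g. integrable lborel g \<and> (\<forall>\<epsilon>. 0 < \<epsilon> \<and> \<epsilon> < 1 \<longrightarrow>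
      (AE t in lborel. \<bar>t\<bar> < T \<longrightarrow> norm (LINT u|lborel. of_real (f u * exp (- \<epsilon> * u)) * cis (- (t * u))) \<le> g t))"
  shows "(f \<longlongrightarrow> 0) at_top"
proof (rule tendstoI)
  fix e' :: real assume "0 < e'"
  \<comment> \<open>At a grid point \<open>f\<close> is below \<open>3 * e\<close>: two parts from
    \<open>approx\<close>, one from the smallness of \<open>L\<close>. Passing to a general
    \<open>u\<close> costs a fourth, and the fifth is slack.\<close>
  define e where "e = e' / 5"
  have e: "0 < e" using \<open>0 < e'\<close> by (simp add: e_def)
  define c where "c = (LINT v|lborel. jackson v)"
  have c: "0 < c" using integral_jackson_pos by (simp add: c_def)
  have A: "0 \<le> A" using lin[of 0 0] by simp
  \<comment> \<open>Comparison with the point -1, where \<open>f\<close> vanishes, yields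
    \<open>1 + \<bar>u + 1\<bar> = 2 + u\<close>.\<close>
  have flin: "\<bar>f u\<bar> \<le> A * (2 + u)" if "0 \<le> u" for u
    using lin[of u "-1"] neg[of "-1"] that by simp
  let ?w = "\<lambda>v. (1 + \<bar>v\<bar>) * jackson v"
  have "(\<lambda>V. LINT v|lborel. A * (?w v * indicator {v. real V < \<bar>v\<bar>} v)) \<longlonglongrightarrow> (LINT v::real|lborel. 0)"
  proof (rule integral_dominated_convergence[where w = "\<lambda>v. A * ?w v"])
    show "AE v in lborel. (\<lambda>V. A * (?w v * indicator {v. real V < \<bar>v\<bar>} v)) \<longlonglongrightarrow> 0"
    proof (rule AE_I2, rule tendsto_eventually)
      fix v :: real
      obtain V0 :: nat where "\<bar>v\<bar> \<le> V0" using real_arch_simple by blast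
      thus "\<forall>\<^sub>F V in sequentially. A * (?w v * indicator {v. real V < \<bar>v\<bar>} v) = 0"
        unfolding eventually_sequentially by (intro exI[of _ V0]) (auto simp: indicator_def)
    qed
    show "integrable lborel (\<lambda>v. A * ?w v)" using integrable_jackson_weighted by simp
  qed (use A jackson_nonneg in \<open>auto simp: indicator_def\<close>)
  hence "eventually (\<lambda>V. (LINT v|lborel. A * (?w v * indicator {v. real V < \<bar>v\<bar>} v)) < e * c) sequentially"
    using e c by (auto dest!: order_tendstoD(2)[where a = "e * c"])
  then obtain V :: nat where V: "(LINT v|lborel. A * (?w v * indicator {v. real V < \<bar>v\<bar>} v)) < e * c"
    by (auto simp: eventually_sequentially)
  obtain \<delta> U0 where \<delta>: "0 < \<delta>" and osc0: "\<And>u v. U0 \<le> u \<Longrightarrow> u \<le> v \<Longrightarrow> v \<le> u + \<delta> \<Longrightarrow> \<bar>f v - f u\<bar> \<le> e"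
    using slow[OF e] by blast
  have osc: "\<bar>f v - f u\<bar> \<le> e" if "U0 \<le> u" "U0 \<le> v" "\<bar>v - u\<bar> \<le> \<delta>" for u v
    using osc0[of u v] osc0[of v u] that by (cases "u \<le> v") (auto simp: abs_minus_commute)
  \<comment> \<open>\<open>V / \<delta>\<close> makes the bulk \<open>\<bar>v\<bar> \<le> V\<close>
    shift the argument by at most \<delta>. The lower bound 1 makes
    \<open>\<bar>v / \<rho>\<bar> \<le> \<bar>v\<bar>\<close>, so that the tail estimate is free of
    \<rho>; this is why \<open>V\<close> could be fixed first.\<close>
  define \<rho> where "\<rho> = max 1 (V / \<delta>)"
  have \<rho>: "1 \<le> \<rho>" "V / \<rho> \<le> \<delta>" using \<delta> by (auto simp: \<rho>_def max_def field_simps)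
  \<comment> \<open>The first entry makes [-\<Lambda>, \<Lambda>] contain the support of the dilated
    spline; the second makes the grid of spacing \<open>pi / \<Lambda>\<close> at most \<delta>
    wide.\<close>
  define \<Lambda> where "\<Lambda> = max (2 * \<rho>) (pi / \<delta>)"
  have \<Lambda>: "0 < \<Lambda>" "2 * \<rho> \<le> \<Lambda>" "pi / \<Lambda> \<le> \<delta>"
  proof -
    show 1: "0 < \<Lambda>" "2 * \<rho> \<le> \<Lambda>" using \<rho> by (auto simp: \<Lambda>_def)
    have "pi / \<delta> \<le> \<Lambda>" by (simp add: \<Lambda>_def)
    thus "pi / \<Lambda> \<le> \<delta>" using 1 \<delta> by (simp add: field_simps)
  qed
  define L where "L = (\<lambda>h. LINT v|lborel. f (h - v / \<rho>) * jackson v)"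
  have shift: "\<bar>f h - f (h - v / \<rho>)\<bar> \<le> A * (1 + \<bar>v\<bar>)" if "0 \<le> h" for h v
  proof -
    have "\<bar>v\<bar> / \<rho> \<le> \<bar>v\<bar>" using \<rho>(1) mult_right_mono[of 1 \<rho> "\<bar>v\<bar>"] by (simp add: field_simps)
    hence "A * (1 + \<bar>h - (h - v / \<rho>)\<bar>) \<le> A * (1 + \<bar>v\<bar>)"
      using A \<rho> by (intro mult_left_mono) auto
    thus ?thesis using lin[OF that, of "h - v / \<rho>"] by linarith
  qed
  have bound: "\<bar>f (h - v / \<rho>)\<bar> * jackson v \<le> (\<bar>f h\<bar> + A) * ?w v" if "0 \<le> h" for h v
  proof -
    have "\<bar>f (h - v / \<rho>)\<bar> \<le> \<bar>f h\<bar> * 1 + A * (1 + \<bar>v\<bar>)" using shift[OF that, of v] by simp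
    also have "\<dots> \<le> \<bar>f h\<bar> * (1 + \<bar>v\<bar>) + A * (1 + \<bar>v\<bar>)" by (intro add_right_mono mult_left_mono) auto
    finally show ?thesis using jackson_nonneg[of v]
      by (metis distrib_right mult.assoc mult_right_mono)
  qed
  have iL: "integrable lborel (\<lambda>v. f (h - v / \<rho>) * jackson v)" if "0 \<le> h" for h
    by (rule Bochner_Integration.integrable_bound[of _ "\<lambda>v. (\<bar>f h\<bar> + A) * ?w v"])
       (use integrable_jackson_weighted bound[OF that] jackson_nonneg A in
         \<open>auto simp: abs_mult intro!: AE_I2 order_trans[OF _ abs_ge_self]\<close>)
  have approx: "\<bar>c * f h - L h\<bar> \<le> 2 * e * c" if h: "0 \<le> h" "U0 + \<delta> \<le> h" for h
  proof -
    have "f h * c - L h = (LINT v|lborel. (f h - f (h - v / \<rho>)) * jackson v)"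
      using iL[OF h(1)] integrable_jackson by (simp add: left_diff_distrib c_def L_def)
    hence "\<bar>c * f h - L h\<bar> = norm (LINT v|lborel. (f h - f (h - v / \<rho>)) * jackson v)"
      by (simp add: mult.commute)
    also have "\<dots> \<le> (LINT v|lborel. e * jackson v + A * (?w v * indicator {v. real V < \<bar>v\<bar>} v))"
    proof (rule Bochner_Integration.integral_norm_bound_integral)
      show "integrable lborel (\<lambda>v. (f h - f (h - v / \<rho>)) * jackson v)"
        using iL[OF h(1)] integrable_jackson by (simp add: left_diff_distrib)
      show "integrable lborel (\<lambda>v. e * jackson v + A * (?w v * indicator {v. real V < \<bar>v\<bar>} v))"
        using integrable_jackson integrable_jackson_weighted
        by (intro Bochner_Integration.integrable_add integrable_mult_right integrable_real_mult_indicator) auto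
      fix v
      show "norm ((f h - f (h - v / \<rho>)) * jackson v) \<le> e * jackson v + A * (?w v * indicator {v. real V < \<bar>v\<bar>} v)"
      proof (cases "real V < \<bar>v\<bar>")
        case True
        have "\<bar>f h - f (h - v / \<rho>)\<bar> * jackson v \<le> A * (1 + \<bar>v\<bar>) * jackson v"
          by (intro mult_right_mono shift h jackson_nonneg)
        thus ?thesis using True e jackson_nonneg[of v] by (simp add: abs_mult add_increasing mult.assoc)
      next
        case False
        have "\<bar>v / \<rho>\<bar> \<le> V / \<rho>" using False \<rho> by (simp add: divide_right_mono)
        hence "\<bar>v / \<rho>\<bar> \<le> \<delta>" using \<rho> by linarith
        hence "\<bar>f h - f (h - v / \<rho>)\<bar> \<le> e" using h \<delta> by (intro osc) linarith+
        thus ?thesis using False jackson_nonneg[of v] by (simp add: abs_mult mult_right_mono)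
      qed
    qed
    also have "\<dots> = e * c + (LINT v|lborel. A * (?w v * indicator {v. real V < \<bar>v\<bar>} v))"
      unfolding c_def
      by (subst Bochner_Integration.integral_add)
         (use integrable_jackson integrable_jackson_weighted in
          \<open>auto intro!: integrable_mult_right integrable_real_mult_indicator simp del: integrable_mult_right_iff\<close>)
    finally show ?thesis using V by linarith
  qed
  \<comment> \<open>The 2 keeps \<open>\<epsilon> n\<close> strictly below 1 even for
    \<open>n = 0\<close>.\<close>
  define \<epsilon> where "\<epsilon> = (\<lambda>n::nat. 1 / (real n + 2))"
  have \<epsilon>: "0 < \<epsilon> n" "\<epsilon> n < 1" for n by (auto simp: \<epsilon>_def)
  have \<epsilon>0: "\<epsilon> \<longlonglongrightarrow> 0" unfolding \<epsilon>_def
    using LIMSEQ_ignore_initial_segment[OF lim_const_over_n[of "1::real"], of 2] by (simp add: add.commute)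
  \<comment> \<open>The extra 1 is there because \<open>dom\<close> covers only
    \<open>\<bar>t\<bar> < T\<close>, while the end points of the support are to be
    included.\<close>
  obtain g where g: "integrable lborel g" and gdom: "\<And>\<epsilon>. 0 < \<epsilon> \<Longrightarrow> \<epsilon> < 1 \<Longrightarrow>
      AE t in lborel. \<bar>t\<bar> < 2 * \<rho> + 1 \<longrightarrow> norm (LINT u|lborel. of_real (f u * exp (- \<epsilon> * u)) * cis (- (t * u))) \<le> g t"
    using dom[of "2 * \<rho> + 1"] \<rho> by auto
  define G where "G = (\<lambda>n t. complex_of_real (bspline (t / \<rho>)) *
      (LINT u|lborel. of_real (f u * exp (- \<epsilon> n * u)) * cis (- (t * u))))"
  have G0: "G n t = 0" if "2 * \<rho> < \<bar>t\<bar>" for n t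
  proof -
    have "2 < \<bar>t / \<rho>\<bar>" using that \<rho> by (simp add: field_simps)
    thus ?thesis by (simp add: G_def bspline_eq_0)
  qed
  have GL: "(\<lambda>n. LINT t|lborel. G n t * cis (h * t)) \<longlonglongrightarrow> of_real (L h)" if h: "0 \<le> h" for h
  proof -
    have "(\<lambda>n. LINT v|lborel. f (h - v / \<rho>) * exp (- \<epsilon> n * (h - v / \<rho>)) * jackson v) \<longlonglongrightarrow> L h"
      unfolding L_def
    proof (rule integral_dominated_convergence[where w = "\<lambda>v. (\<bar>f h\<bar> + A) * ?w v"])
      show "AE v in lborel. (\<lambda>n. f (h - v / \<rho>) * exp (- \<epsilon> n * (h - v / \<rho>)) * jackson v) \<longlonglongrightarrow> f (h - v / \<rho>) * jackson v"
        by (rule AE_I2) (use \<epsilon>0 in \<open>auto intro!: tendsto_eq_intros\<close>)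
      fix n
      \<comment> \<open>For negative \<open>u\<close> the exponential exceeds 1, but there
        \<open>f\<close> is 0.\<close>
      have "\<bar>f u * exp (- \<epsilon> n * u)\<bar> \<le> \<bar>f u\<bar>" for u
        using neg[of u] \<epsilon>[of n] by (cases "u < 0") (auto simp: abs_mult mult_left_le)
      hence "\<bar>f (h - v / \<rho>) * exp (- \<epsilon> n * (h - v / \<rho>))\<bar> * jackson v \<le> (\<bar>f h\<bar> + A) * ?w v" for v
        using bound[OF h, of v] jackson_nonneg[of v] by (meson mult_right_mono order_trans)
      thus "AE v in lborel. norm (f (h - v / \<rho>) * exp (- \<epsilon> n * (h - v / \<rho>)) * jackson v) \<le> (\<bar>f h\<bar> + A) * ?w v"
        using jackson_nonneg by (intro AE_I2) (simp add: abs_mult)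
    qed (use integrable_jackson_weighted in auto)
    from tendsto_of_real[OF this, where 'a = complex]
    show ?thesis unfolding G_def
      using integral_bspline_laplace[OF integrable_linear_growth_exp[OF fm neg flin \<epsilon>(1)], of \<rho>] \<rho>(1) by simp
  qed
  have "(\<lambda>k. complex_of_real (L (real k * pi / \<Lambda>))) \<longlonglongrightarrow> 0"
  proof (rule dominated_riemann_lebesgue[OF \<Lambda>(1)])
    show "integrable lborel (\<lambda>t. 13 * norm (g t))" using g by simp
    show "G n \<in> borel_measurable borel" for n unfolding G_def by measurable
    show "AE t in lborel. norm (G n t) \<le> 13 * norm (g t)" for n
      using gdom[OF \<epsilon>[of n]]
    proof eventually_elim
      case (elim t)
      show ?case
      proof (cases "2 * \<rho> < \<bar>t\<bar>")
        case False
        hence "norm (LINT u|lborel. of_real (f u * exp (- \<epsilon> n * u)) * cis (- (t * u))) \<le> norm (g t)"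
          using elim by auto
        thus ?thesis unfolding G_def norm_mult
          by (intro mult_mono) (auto simp: abs_bspline_le)
      qed (simp add: G0)
    qed
    show "G n t = 0" if "\<Lambda> < \<bar>t\<bar>" for n t using G0[of t n] that \<Lambda>(2) by simp
    show "(\<lambda>n. LINT t|lborel. G n t * cis (real k * pi / \<Lambda> * t)) \<longlonglongrightarrow> of_real (L (real k * pi / \<Lambda>))" for k
      by (rule GL) (use \<Lambda> in auto)
  qed
  hence "eventually (\<lambda>k. norm (complex_of_real (L (real k * pi / \<Lambda>))) < e * c) sequentially"
    using e c by (intro order_tendstoD(2)[OF tendsto_norm_zero]) auto
  then obtain k0 where k0: "\<And>k. k0 \<le> k \<Longrightarrow> \<bar>L (real k * pi / \<Lambda>)\<bar> < e * c"
    by (auto simp: eventually_sequentially)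
  define d where "d = pi / \<Lambda>"
  have d: "0 < d" "d \<le> \<delta>" using \<Lambda> by (auto simp: d_def)
  \<comment> \<open>The summand \<open>d\<close> pays for moving from \<open>u\<close> down to the
    grid point below it, and \<open>\<bar>U0\<bar>\<close> keeps that point nonnegative even if
    \<open>U0\<close> is negative. Likewise \<open>real k0 + 1\<close> leaves room for rounding
    down.\<close>
  have small: "\<bar>f u\<bar> < e'" if u: "(real k0 + 1) * d \<le> u" "\<bar>U0\<bar> + \<delta> + d \<le> u" for u
  proof -
    define k where "k = nat \<lfloor>u / d\<rfloor>"
    have u0: "0 \<le> u" using u(2) d \<delta> by linarith
    have k: "real k \<le> u / d" "u / d < real k + 1" using u0 d by (auto simp: k_def of_nat_nat)
    have kd: "real k * d \<le> u" "u < real k * d + d" using k d by (auto simp: field_simps)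
    have "k0 \<le> k"
    proof -
      have "real k0 + 1 \<le> u / d" using u(1) d by (simp add: field_simps)
      thus ?thesis using k by linarith
    qed
    from k0[OF this] have Lk: "\<bar>L (real k * d)\<bar> < e * c" by (simp add: d_def)
    have "0 \<le> real k * d" "U0 + \<delta> \<le> real k * d" using kd u d by auto
    note approx[OF this]
    hence "\<bar>c * f (real k * d)\<bar> < c * (3 * e)" using Lk by (simp add: algebra_simps)
    hence "\<bar>f (real k * d)\<bar> < 3 * e" using c by (simp add: abs_mult)
    moreover have "\<bar>f u - f (real k * d)\<bar> \<le> e"
      using kd d u by (intro osc) auto
    ultimately show ?thesis using e unfolding e_def by linarith
  qed
  show "eventually (\<lambda>u. dist (f u) 0 < e') at_top"
    unfolding eventually_at_top_linorder
    by (intro exI[of _ "max ((real k0 + 1) * d) (\<bar>U0\<bar> + \<delta> + d)"]) (auto intro: small)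
qed

subsection \<open>Oscillation and Laplace transform of \<open>m\<close>\<close>

lemma beurling_N_le_linear:
  assumes p: "beurling_primes p" and N: "beurling_N p \<sim>[at_top] (\<lambda>x. a * x)"
  obtains C where "0 \<le> C" "\<And>x. 1 \<le> x \<Longrightarrow> beurling_N p x \<le> C * x"
proof -
  have "beurling_N p \<in> O(\<lambda>x. a * x)" by (rule asymp_equiv_imp_bigo[OF N])
  also have "(\<lambda>x. a * x) \<in> O(\<lambda>x. x)" by simp
  finally obtain c where "eventually (\<lambda>x. norm (beurling_N p x) \<le> c * norm x) at_top"
    by (rule landau_o.bigE)
  then obtain X where X: "\<And>x. X \<le> x \<Longrightarrow> norm (beurling_N p x) \<le> c * norm x"
    by (auto simp: eventually_at_top_linorder)
  have mono: "beurling_N p x \<le> beurling_N p y" if "x \<le> y" for x y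
    unfolding beurling_N_def using that
    by (intro of_nat_mono card_mono finite_beurling_int_le[OF p]) auto
  show ?thesis
  proof (rule that[of "\<bar>c\<bar> + beurling_N p X"])
    show "0 \<le> \<bar>c\<bar> + beurling_N p X" by (simp add: beurling_N_def)
    fix x :: real assume x: "1 \<le> x"
    have N0: "0 \<le> beurling_N p X" by (simp add: beurling_N_def)
    show "beurling_N p x \<le> (\<bar>c\<bar> + beurling_N p X) * x"
    proof (cases "X \<le> x")
      case True
      have "beurling_N p x \<le> c * x" using X[OF True] x by (simp add: beurling_N_def)
      also have "\<dots> \<le> (\<bar>c\<bar> + beurling_N p X) * x" using x N0 by (intro mult_right_mono) auto
      finally show ?thesis .
    next
      case False
      have "beurling_N p x \<le> (\<bar>c\<bar> + beurling_N p X) * 1" using mono[of x X] False by auto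
      also have "\<dots> \<le> (\<bar>c\<bar> + beurling_N p X) * x" using x N0 by (intro mult_left_mono) auto
      finally show ?thesis .
    qed
  qed
qed

lemma abs_beurling_mu_le: "\<bar>beurling_mu A\<bar> \<le> 1"
  by (simp add: beurling_mu_def)

text \<open>Every generalized integer between \<open>x\<close> and \<open>y\<close> contributes at
  most \<open>1 / x\<close>, because the Moebius weight is at most 1 in absolute value. Both
  oscillation estimates for \<open>m\<close> thus reduce to increments of \<open>N\<close>.\<close>

lemma beurling_m_diff_le:
  assumes p: "beurling_primes p" and x: "0 < x" "x \<le> y"
  shows "\<bar>beurling_m p y - beurling_m p x\<bar> \<le> (beurling_N p y - beurling_N p x) / x"
proof -
  let ?Y = "{A. beurling_int p A \<le> y}" and ?X = "{A. beurling_int p A \<le> x}"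
  have sub: "?X \<subseteq> ?Y" using x by auto
  note fin = finite_beurling_int_le[OF p]
  have "\<bar>beurling_m p y - beurling_m p x\<bar> = \<bar>\<Sum>A\<in>?Y - ?X. beurling_mu A / beurling_int p A\<bar>"
    unfolding beurling_m_def by (subst sum_diff[OF fin sub]) (rule refl)
  also have "\<dots> \<le> (\<Sum>A\<in>?Y - ?X. \<bar>beurling_mu A / beurling_int p A\<bar>)" by (rule sum_abs)
  also have "\<dots> \<le> (\<Sum>A\<in>?Y - ?X. 1 / x)"
  proof (rule sum_mono)
    fix A assume "A \<in> ?Y - ?X"
    hence "x < beurling_int p A" by auto
    thus "\<bar>beurling_mu A / beurling_int p A\<bar> \<le> 1 / x"
      using x abs_beurling_mu_le[of A] by (auto simp: abs_div intro!: frac_le)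
  qed
  also have "\<dots> = (beurling_N p y - beurling_N p x) / x"
    using card_Diff_subset[OF fin sub] card_mono[OF fin sub]
    by (simp add: beurling_N_def of_nat_diff)
  finally show ?thesis .
qed

lemma beurling_m_eq_0: "beurling_primes p \<Longrightarrow> x < 1 \<Longrightarrow> beurling_m p x = 0"
  using beurling_int_ge_1[of p] unfolding beurling_m_def
  by (intro sum.neutral) (metis (mono_tags) mem_Collect_eq not_le order_trans)

text \<open>\<open>m\<close> is not monotone, but adding and subtracting the weights
  \<open>1 / n\<close> writes it as a difference of two sums with nonnegative weights, which
  are.\<close>

lemma beurling_m_measurable:
  assumes p: "beurling_primes p" shows "beurling_m p \<in> borel_measurable borel"
proof -
  let ?n = "beurling_int p"
  have n: "0 < ?n A" for A using beurling_int_ge_1[OF p, of A] by linarith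
  have [measurable]: "(\<lambda>x. \<Sum>A | ?n A \<le> x. (1 + beurling_mu A) / ?n A) \<in> borel_measurable borel"
  proof (intro borel_measurable_mono discrete_counting_mono finite_beurling_int_le[OF p])
    show "0 \<le> (1 + beurling_mu A) / ?n A" for A
      using abs_beurling_mu_le[of A] n[of A] by simp
  qed
  have [measurable]: "(\<lambda>x. \<Sum>A | ?n A \<le> x. 1 / ?n A) \<in> borel_measurable borel"
    by (intro borel_measurable_mono discrete_counting_mono finite_beurling_int_le[OF p])
       (use n in \<open>simp add: less_imp_le\<close>)
  have "beurling_m p = (\<lambda>x. (\<Sum>A | ?n A \<le> x. (1 + beurling_mu A) / ?n A) - (\<Sum>A | ?n A \<le> x. 1 / ?n A))"
    by (simp add: beurling_m_def fun_eq_iff add_divide_distrib flip: sum_subtractf)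
  thus ?thesis by simp
qed

text \<open>Over a unit step in \<open>u\<close> the value \<open>m (exp u)\<close> changes by at
  most \<open>C * exp 1\<close>, and such steps are chained. The point \<open>u\<close> may be
  negative because the kernel shifts \<open>h\<close> along the whole line.\<close>

lemma beurling_m_exp_linear_osc:
  assumes p: "beurling_primes p" and N: "beurling_N p \<sim>[at_top] (\<lambda>x. a * x)"
  obtains A where "\<And>h u. 0 \<le> h \<Longrightarrow> \<bar>beurling_m p (exp h) - beurling_m p (exp u)\<bar> \<le> A * (1 + \<bar>h - u\<bar>)"
proof -
  define f where "f u = beurling_m p (exp u)" for u
  obtain C where C: "0 \<le> C" "\<And>x. 1 \<le> x \<Longrightarrow> beurling_N p x \<le> C * x"
    using beurling_N_le_linear[OF p N] by blast
  define D where "D = C * exp 1"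
  have D: "0 \<le> D" using C by (simp add: D_def)
  have step: "\<bar>f v - f u\<bar> \<le> D" if "0 \<le> u" "u \<le> v" "v \<le> u + 1" for u v
  proof -
    have "\<bar>f v - f u\<bar> \<le> (beurling_N p (exp v) - beurling_N p (exp u)) / exp u"
      unfolding f_def by (rule beurling_m_diff_le[OF p]) (use that in auto)
    also have "\<dots> \<le> beurling_N p (exp v) / exp u" by (simp add: divide_right_mono beurling_N_def)
    also have "\<dots> \<le> C * exp v / exp u" using C(2)[of "exp v"] that by (intro divide_right_mono) auto
    also have "\<dots> = C * exp (v - u)" by (simp add: exp_diff)
    also have "\<dots> \<le> C * exp 1" using that C by (intro mult_left_mono) auto
    finally show ?thesis by (simp add: D_def)
  qed
  have steps: "\<bar>f v - f u\<bar> \<le> D * real n" if "0 \<le> u" "u \<le> v" "v \<le> u + real n" for u v n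
    using that
  proof (induction n arbitrary: v)
    case (Suc n)
    define w where "w = max u (v - 1)"
    have "\<bar>f w - f u\<bar> \<le> D * real n" using Suc.prems by (intro Suc.IH) (auto simp: w_def)
    moreover have "\<bar>f v - f w\<bar> \<le> D" using Suc.prems by (intro step) (auto simp: w_def)
    ultimately show ?case by (simp add: algebra_simps)
  qed simp
  have up: "\<bar>f v - f u\<bar> \<le> D * (1 + \<bar>v - u\<bar>)" if "0 \<le> u" "u \<le> v" for u v
  proof -
    have "\<bar>f v - f u\<bar> \<le> D * real (nat \<lceil>v - u\<rceil>)" using that by (intro steps) linarith+
    also have "\<dots> \<le> D * (1 + \<bar>v - u\<bar>)" using D that by (intro mult_left_mono) linarith+
    finally show ?thesis .
  qed
  show ?thesis
  \<comment> \<open>\<open>\<bar>f 0\<bar>\<close> pays for the jump at 0: \<open>f\<close> vanishes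
    to the left of it.\<close>
  proof (rule that[of "D + \<bar>f 0\<bar>"], fold f_def)
    fix h u :: real assume h: "0 \<le> h"
    have le: "D * (1 + \<bar>h - u\<bar>) \<le> (D + \<bar>f 0\<bar>) * (1 + \<bar>h - u\<bar>)" by (intro mult_right_mono) auto
    show "\<bar>f h - f u\<bar> \<le> (D + \<bar>f 0\<bar>) * (1 + \<bar>h - u\<bar>)"
    proof (cases "0 \<le> u")
      case True
      have "\<bar>f h - f u\<bar> \<le> D * (1 + \<bar>h - u\<bar>)"
        using up[of u h] up[of h u] h True by (metis abs_minus_commute linear)
      thus ?thesis using le by linarith
    next
      case False
      hence "f u = 0" using beurling_m_eq_0[OF p] by (simp add: f_def)
      hence "\<bar>f h - f u\<bar> \<le> \<bar>f h - f 0\<bar> + \<bar>f 0\<bar> * 1" by simp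
      also have "\<dots> \<le> D * (1 + \<bar>h - u\<bar>) + \<bar>f 0\<bar> * (1 + \<bar>h - u\<bar>)"
      proof (intro add_mono mult_left_mono)
        have "\<bar>f h - f 0\<bar> \<le> D * (1 + \<bar>h - 0\<bar>)" using up[of 0 h] h by simp
        also have "\<dots> \<le> D * (1 + \<bar>h - u\<bar>)" using D h False by (intro mult_left_mono) auto
        finally show "\<bar>f h - f 0\<bar> \<le> D * (1 + \<bar>h - u\<bar>)" .
      qed auto
      finally show ?thesis by (simp add: distrib_right)
    qed
  qed
qed

lemma beurling_m_exp_slow_osc:
  assumes p: "beurling_primes p" and a: "0 < a" and N: "beurling_N p \<sim>[at_top] (\<lambda>x. a * x)" and e: "0 < e"
  shows "\<exists>\<delta>>0. \<exists>U. \<forall>u v. U \<le> u \<and> u \<le> v \<and> v \<le> u + \<delta> \<longrightarrow>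
    \<bar>beurling_m p (exp v) - beurling_m p (exp u)\<bar> \<le> e"
proof -
  \<comment> \<open>In the final estimate \<open>a * \<kappa>\<close> takes \<open>e / 2\<close>,
    and \<open>\<eta> * \<kappa> + 2 * \<eta>\<close> takes at most \<open>3 * \<eta>\<close>, the
    other half. The term \<open>2 * \<eta>\<close> is the error of \<open>N\<close> at both
    ends.\<close>
  define \<eta> where "\<eta> = e / 6"
  have \<eta>: "0 < \<eta>" using e by (simp add: \<eta>_def)
  define \<kappa> where "\<kappa> = min 1 (e / (2 * a))"
  have \<kappa>: "0 < \<kappa>" "\<kappa> \<le> 1" "a * \<kappa> \<le> e / 2"
  proof -
    have "a * \<kappa> \<le> a * (e / (2 * a))" unfolding \<kappa>_def using a by (intro mult_left_mono) auto
    thus "a * \<kappa> \<le> e / 2" using a by simp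
  qed (use a e in \<open>auto simp: \<kappa>_def\<close>)
  have "(\<lambda>x. beurling_N p x - a * x) \<in> o(\<lambda>x. a * x)"
    by (rule asymp_equiv_imp_diff_smallo[OF N])
  from landau_o.smallD[OF this, of "\<eta> / a"]
  have "eventually (\<lambda>x. norm (beurling_N p x - a * x) \<le> \<eta> / a * norm (a * x)) at_top"
    using \<eta> a by simp
  then obtain X where X: "\<And>x. X \<le> x \<Longrightarrow> norm (beurling_N p x - a * x) \<le> \<eta> / a * norm (a * x)"
    by (auto simp: eventually_at_top_linorder)
  have X': "\<bar>beurling_N p x - a * x\<bar> \<le> \<eta> * x" if "max 1 X \<le> x" for x
    using X[of x] that a by (simp add: abs_mult)
  have main: "\<bar>beurling_m p y - beurling_m p x\<bar> \<le> e" if "max 1 X \<le> x" "x \<le> y" "y \<le> (1 + \<kappa>) * x" for x y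
  proof -
    have x: "0 < x" using that by linarith
    have "beurling_N p y - beurling_N p x \<le> (a + \<eta>) * y - (a - \<eta>) * x"
      using X'[of x] X'[of y] that by (simp add: algebra_simps)
    also have "\<dots> \<le> (a + \<eta>) * ((1 + \<kappa>) * x) - (a - \<eta>) * x"
      using that a \<eta> by (intro diff_right_mono mult_left_mono) auto
    also have "\<dots> = (a * \<kappa> + \<eta> * \<kappa> + 2 * \<eta>) * x" by (simp add: algebra_simps)
    also have "\<dots> \<le> e * x"
    proof (intro mult_right_mono)
      have "\<eta> * \<kappa> \<le> \<eta> * 1" using \<kappa> \<eta> by (intro mult_left_mono) auto
      thus "a * \<kappa> + \<eta> * \<kappa> + 2 * \<eta> \<le> e" using \<kappa>(3) unfolding \<eta>_def by linarith
    qed (use x in simp)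
    finally have "(beurling_N p y - beurling_N p x) / x \<le> e" using x by (simp add: field_simps)
    thus ?thesis using beurling_m_diff_le[OF p x that(2)] by linarith
  qed
  show ?thesis
  proof (rule exI[of _ "ln (1 + \<kappa>)"], rule conjI, goal_cases)
    case 1
    show "0 < ln (1 + \<kappa>)" using \<kappa> by simp
  next
    case 2
    show ?case
    proof (rule exI[of _ "ln (max 1 X)"], intro allI impI)
    fix u v assume uv: "ln (max 1 X) \<le> u \<and> u \<le> v \<and> v \<le> u + ln (1 + \<kappa>)"
    have "exp v \<le> exp (u + ln (1 + \<kappa>))" using uv by simp
    hence v: "exp v \<le> (1 + \<kappa>) * exp u" using \<kappa> by (simp add: exp_add mult.commute)
    have "exp (ln (max 1 X)) \<le> exp u" using uv by (simp only: exp_le_cancel_iff)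
    hence "max 1 X \<le> exp u" by (subst (asm) exp_ln) auto
    thus "\<bar>beurling_m p (exp v) - beurling_m p (exp u)\<bar> \<le> e"
      using v uv by (intro main) auto
    qed
  qed
qed

section \<open>Laplace transforms of step functions and of \<open>m (exp u)\<close>\<close>

lemma integral_exp_atLeast:
  fixes s :: complex and l :: real
  assumes s: "0 < Re s" and l: "0 \<le> l"
  shows "integrable lborel (\<lambda>u. indicator {l..} u *\<^sub>R exp (- s * of_real u))"
    and "(LINT u|lborel. indicator {l..} u *\<^sub>R exp (- s * of_real u)) = exp (- s * of_real l) / s"
proof -
  have s0: "s \<noteq> 0" using s by auto
  have "integrable lborel (\<lambda>u. indicator {l..} u * exp (- Re s * u))"
    by (rule integrable_linear_growth_exp[where A = 1]) (use s l in \<open>auto simp: indicator_def\<close>)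
  thus int: "integrable lborel (\<lambda>u. indicator {l..} u *\<^sub>R exp (- s * of_real u))"
    by (rule Bochner_Integration.integrable_bound) (auto simp: indicator_def)
  let ?F = "\<lambda>u::real. - exp (- s * of_real u) / s"
  have deriv: "(?F has_vector_derivative exp (- s * of_real u)) (at u within S)" for u S
    using s0 by (auto intro!: derivative_eq_intros has_vector_derivative_real_field)
  have "(\<lambda>n. LINT u|lborel. indicator {l..l + real n} u *\<^sub>R exp (- s * of_real u)) \<longlonglongrightarrow>
     (LINT u|lborel. indicator {l..} u *\<^sub>R exp (- s * of_real u))"
  proof (rule integral_dominated_convergence[OF _ _ integrable_norm[OF int]])
    show "AE u in lborel. (\<lambda>n. indicator {l..l + real n} u *\<^sub>R exp (- s * of_real u)) \<longlonglongrightarrow>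
        indicator {l..} u *\<^sub>R exp (- s * of_real u)"
    proof (rule AE_I2, rule tendsto_eventually)
      fix u :: real
      obtain n0 :: nat where "u - l \<le> n0" using real_arch_simple by blast
      thus "\<forall>\<^sub>F n in sequentially. indicator {l..l + real n} u *\<^sub>R exp (- s * of_real u) =
          indicator {l..} u *\<^sub>R exp (- s * of_real u)"
        unfolding eventually_sequentially by (intro exI[of _ n0]) (auto simp: indicator_def)
    qed
  qed (auto simp: indicator_def)
  moreover have "(LINT u|lborel. indicator {l..l + real n} u *\<^sub>R exp (- s * of_real u)) =
      exp (- s * of_real l) / s - exp (- s * of_real (l + real n)) / s" for n
    by (subst integral_FTC_atLeastAtMost[where F = ?F])
       (use deriv in \<open>auto intro!: continuous_intros\<close>)
  moreover have "(\<lambda>n. exp (- s * of_real (l + real n))) \<longlonglongrightarrow> 0"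
  proof (rule tendsto_norm_zero_cancel)
    have "filterlim (\<lambda>n. Re s * (l + real n)) at_top sequentially"
      using s by (intro filterlim_tendsto_pos_mult_at_top[OF tendsto_const] filterlim_tendsto_add_at_top[OF tendsto_const]
           filterlim_real_sequentially) auto
    hence "filterlim (\<lambda>n. - (Re s * (l + real n))) at_bot sequentially"
      by (simp add: filterlim_uminus_at_bot)
    from filterlim_compose[OF exp_at_bot this]
    show "(\<lambda>n. norm (exp (- s * of_real (l + real n)))) \<longlonglongrightarrow> 0" by simp
  qed
  hence "(\<lambda>n. exp (- s * of_real l) / s - exp (- s * of_real (l + real n)) / s) \<longlonglongrightarrow> exp (- s * of_real l) / s - 0 / s"
    by (intro tendsto_intros s0)
  ultimately show "(LINT u|lborel. indicator {l..} u *\<^sub>R exp (- s * of_real u)) = exp (- s * of_real l) / s"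
    using LIMSEQ_unique by fastforce
qed

text \<open>\<open>m (exp u)\<close> is a superposition of steps of height \<open>\<mu> / n\<close>
  at \<open>ln n\<close>, each with transform \<open>\<mu> * n powr (- 1 - s) / s\<close>; summation
  gives the Dirichlet series of \<open>1 / \<zeta>\<close> at \<open>1 + s\<close>. The interchange
  is Fubini on counting measure times Lebesgue measure.\<close>

lemma laplace_beurling_m:
  assumes p: "beurling_primes p" and N: "beurling_N p \<sim>[at_top] (\<lambda>x. a * x)" and s: "0 < Re s"
  shows "(LINT u|lborel. of_real (beurling_m p (exp u)) * exp (- s * of_real u)) =
    1 / (s * beurling_zeta p (1 + s))"
proof -
  let ?n = "beurling_int p"
  have n1: "1 \<le> ?n A" for A by (rule beurling_int_ge_1[OF p])
  have n0: "0 < ?n A" for A using n1[of A] by linarith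
  define c where "c = (\<lambda>A. beurling_mu A / ?n A)"
  define F where "F = (\<lambda>A u. complex_of_real (c A) * (indicator {ln (?n A)..} u *\<^sub>R exp (- s * of_real u)))"
  have expn: "exp (- s * of_real (ln (?n A))) = of_real (?n A) powr (- s)" for A
    using n0[of A] by (simp add: powr_def Ln_of_real)
  have summand: "complex_of_real (c A) * exp (- s * of_real (ln (?n A))) =
      of_real (beurling_mu A) * of_real (?n A) powr (- (1 + s))" for A
  proof -
    have "- (1 + s) = - s - 1" by simp
    hence "complex_of_real (?n A) powr (- (1 + s)) = of_real (?n A) powr (- s - 1)" by (simp only:)
    also have "\<dots> = of_real (?n A) powr (- s) / of_real (?n A)" using n0[of A] by (simp add: powr_diff)
    finally show ?thesis unfolding expn c_def by simp
  qed
  have sm: "(\<lambda>A. ?n A powr (- (1 + Re s))) summable_on UNIV"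
    using beurling_int_powr_summable[OF p N, of "1 + Re s"] s by simp
  have sm': "(\<lambda>A. norm (of_real (beurling_mu A) * complex_of_real (?n A) powr (- (1 + s)))) summable_on UNIV"
  proof (rule summable_on_comparison_test[OF sm])
    show "norm (of_real (beurling_mu A) * complex_of_real (?n A) powr (- (1 + s))) \<le> ?n A powr (- (1 + Re s))" for A
      using norm_beurling_int_powr[OF p, of A "1 + s"] abs_beurling_mu_le[of A]
      by (simp add: norm_mult mult_left_le_one_le)
  qed simp
  note E = integral_exp_atLeast[OF s]
  have E': "(LINT u|lborel. F A u) = of_real (beurling_mu A) * of_real (?n A) powr (- (1 + s)) / s" for A
  proof -
    have "(LINT u|lborel. F A u) = of_real (c A) * (exp (- s * of_real (ln (?n A))) / s)"
      unfolding F_def integral_mult_right_zero using E(2)[of "ln (?n A)"] n1[of A] by simp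
    thus ?thesis using summand[of A] by (metis times_divide_eq_right)
  qed
  \<comment> \<open>Fubini needs the counting measure to be sigma-finite.\<close>
  have countable: "countable (UNIV :: nat multiset set)"
  proof -
    have "(UNIV :: nat multiset set) = (\<Union>k::nat. {A. ?n A \<le> real k})"
      by (auto simp: real_arch_simple)
    thus ?thesis
      by (metis countable_UN countable_finite finite_beurling_int_le[OF p] countableI_type)
  qed
  interpret pair_sigma_finite "count_space (UNIV :: nat multiset set)" "lborel :: real measure"
    by (intro pair_sigma_finite.intro sigma_finite_measure_count_space_countable[OF countable] sigma_finite_lborel)
  have [measurable]: "(\<lambda>(A, u). F A u) \<in> borel_measurable (count_space UNIV \<Otimes>\<^sub>M lborel)"
    by (rule measurable_pair_measure_countable1[OF countable]) (auto simp: F_def)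
  \<comment> \<open>Taking norms replaces \<open>s\<close> by its real part in the step integral, so
    absolute integrability reduces to convergence of the sum of
    \<open>n powr (- 1 - Re s)\<close>.\<close>
  have FR: "(LINT u|lborel. norm (F A u)) = norm (of_real (beurling_mu A) * complex_of_real (?n A) powr (- (1 + s))) / Re s" for A
  proof -
    have "complex_of_real (LINT u|lborel. norm (F A u)) = (LINT u|lborel. complex_of_real (norm (F A u)))"
      by (rule integral_complex_of_real[symmetric])
    also have "\<dots> = (LINT u|lborel. complex_of_real \<bar>c A\<bar> * (indicator {ln (?n A)..} u *\<^sub>R exp (- of_real (Re s) * of_real u)))"
      by (intro Bochner_Integration.integral_cong refl)
         (auto simp: F_def norm_mult indicator_def exp_of_real simp flip: of_real_mult of_real_minus)
    also have "\<dots> = complex_of_real \<bar>c A\<bar> * (exp (- of_real (Re s) * of_real (ln (?n A))) / of_real (Re s))"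
      unfolding integral_mult_right_zero
      using integral_exp_atLeast(2)[of "of_real (Re s)" "ln (?n A)"] s n1[of A] by simp
    also have "\<dots> = complex_of_real (norm (complex_of_real (c A) * exp (- s * of_real (ln (?n A)))) / Re s)"
      by (simp add: norm_mult exp_of_real flip: of_real_mult of_real_minus)
    finally show ?thesis unfolding summand of_real_eq_iff .
  qed
  have int: "integrable (count_space UNIV \<Otimes>\<^sub>M lborel) (\<lambda>(A, u). F A u)"
  proof (rule Fubini_integrable)
    show "integrable (count_space UNIV) (\<lambda>A. LINT u|lborel. norm (case (A, u) of (A, u) \<Rightarrow> F A u))"
      unfolding prod.case FR using sm' 
      by (intro integrable_divide) (simp add: abs_summable_equivalent abs_summable_on_def)
    show "AE A in count_space UNIV. integrable lborel (\<lambda>u. case (A, u) of (A, u) \<Rightarrow> F A u)"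
      unfolding F_def prod.case using n1 by (intro AE_I2 integrable_mult_right E(1)) simp
  qed measurable
  have "(LINT A|count_space UNIV. F A u) = of_real (beurling_m p (exp u)) * exp (- s * of_real u)" for u
  proof -
    have le: "ln (?n A) \<le> u \<longleftrightarrow> ?n A \<le> exp u" for A
      using n0[of A] by (metis exp_le_cancel_iff exp_ln)
    have "(LINT A|count_space UNIV. F A u) = (\<Sum>A | F A u \<noteq> 0. F A u)"
      by (subst lebesgue_integral_count_space_finite_support)
         (auto intro: finite_subset[OF _ finite_beurling_int_le[OF p, of "exp u"]] simp: F_def indicator_def le)
    also have "\<dots> = (\<Sum>A | ?n A \<le> exp u. F A u)"
      by (rule sum.mono_neutral_left) (auto simp: finite_beurling_int_le[OF p] F_def indicator_def le)
    also have "\<dots> = (\<Sum>A | ?n A \<le> exp u. complex_of_real (c A) * exp (- s * of_real u))"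
      by (intro sum.cong refl) (auto simp: F_def indicator_def le)
    finally show ?thesis by (simp add: beurling_m_def c_def sum_distrib_right)
  qed
  hence "(LINT u|lborel. of_real (beurling_m p (exp u)) * exp (- s * of_real u)) =
      (LINT u|lborel. LINT A|count_space UNIV. F A u)" by simp
  also have "\<dots> = (LINT A|count_space UNIV. LINT u|lborel. F A u)" by (rule Fubini_integral[OF int])
  also have "\<dots> = (LINT A|count_space UNIV. of_real (beurling_mu A) * of_real (?n A) powr (- (1 + s))) / s"
    unfolding E' by simp
  also have "(LINT A|count_space UNIV. of_real (beurling_mu A) * complex_of_real (?n A) powr (- (1 + s))) =
      (\<Sum>\<^sub>\<infinity>A. of_real (beurling_mu A) * complex_of_real (?n A) powr (- (1 + s)))"
    using infsetsum_infsum[OF abs_summable_equivalent[THEN iffD1, OF sm']] by (simp add: infsetsum_def)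
  also have "\<dots> = 1 / beurling_zeta p (1 + s)"
    by (rule beurling_zeta_identities(2)[OF p N]) (use s in simp)
  finally show ?thesis by simp
qed

subsection \<open>Integrable majorants with power singularities\<close>

text \<open>Singularities at distinct points do not compound: \<open>t\<close> is at least half of
  \<open>\<bar>\<tau> - \<sigma>\<bar>\<close> away from one of \<tau> and \<sigma>, so one of any
  two factors is bounded. The product is thereby reduced to single powers, each integrable by
  itself.\<close>

lemma prod_singularities_le:
  fixes b :: "real \<Rightarrow> real"
  assumes "finite F" and b: "\<And>\<tau>. \<tau> \<in> F \<Longrightarrow> 0 \<le> b \<tau>"
  shows "\<exists>C\<ge>0. \<forall>t. t \<notin> F \<longrightarrow>
    (\<Prod>\<tau>\<in>F. \<bar>t - \<tau>\<bar> powr (- b \<tau>)) \<le> C * (1 + (\<Sum>\<tau>\<in>F. \<bar>t - \<tau>\<bar> powr (- b \<tau>)))"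
  using assms
proof (induction F rule: finite_induct)
  case empty
  show ?case by (intro exI[of _ 1]) simp
next
  case (insert \<sigma> F)
  let ?w = "\<lambda>\<tau> t. \<bar>t - \<tau>\<bar> powr (- b \<tau>)"
  obtain C where C: "0 \<le> C" "\<And>t. t \<notin> F \<Longrightarrow> (\<Prod>\<tau>\<in>F. ?w \<tau> t) \<le> C * (1 + (\<Sum>\<tau>\<in>F. ?w \<tau> t))"
    using insert.IH insert.prems by auto
  define D where "D = (\<lambda>\<tau>. (\<bar>\<tau> - \<sigma>\<bar> / 2) powr (- b \<tau>) + (\<bar>\<tau> - \<sigma>\<bar> / 2) powr (- b \<sigma>))"
  have D0: "0 \<le> D \<tau>" for \<tau> by (simp add: D_def)
  have two: "?w \<tau> t * ?w \<sigma> t \<le> D \<tau> * (?w \<tau> t + ?w \<sigma> t)" if \<tau>: "\<tau> \<in> F" and t: "t \<notin> insert \<sigma> F" for \<tau> t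
  proof -
    have d: "0 < \<bar>\<tau> - \<sigma>\<bar> / 2" using \<tau> insert.hyps by auto
    have "\<bar>\<tau> - \<sigma>\<bar> \<le> \<bar>t - \<tau>\<bar> + \<bar>t - \<sigma>\<bar>" by linarith
    then consider "\<bar>\<tau> - \<sigma>\<bar> / 2 \<le> \<bar>t - \<tau>\<bar>" | "\<bar>\<tau> - \<sigma>\<bar> / 2 \<le> \<bar>t - \<sigma>\<bar>"
      by argo
    thus ?thesis
    proof cases
      case 1
      have "?w \<tau> t \<le> (\<bar>\<tau> - \<sigma>\<bar> / 2) powr (- b \<tau>)" using 1 d insert.prems \<tau> by (intro powr_mono2') auto
      also have "\<dots> \<le> D \<tau>" by (simp add: D_def)
      finally have "?w \<tau> t * ?w \<sigma> t \<le> D \<tau> * ?w \<sigma> t" by (intro mult_right_mono) auto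
      also have "\<dots> \<le> D \<tau> * (?w \<tau> t + ?w \<sigma> t)" using D0 by (intro mult_left_mono) auto
      finally show ?thesis .
    next
      case 2
      have "?w \<sigma> t \<le> (\<bar>\<tau> - \<sigma>\<bar> / 2) powr (- b \<sigma>)" using 2 d insert.prems by (intro powr_mono2') auto
      also have "\<dots> \<le> D \<tau>" by (simp add: D_def)
      finally have "?w \<tau> t * ?w \<sigma> t \<le> ?w \<tau> t * D \<tau>" by (intro mult_left_mono) auto
      also have "\<dots> \<le> D \<tau> * (?w \<tau> t + ?w \<sigma> t)" using D0[of \<tau>] by (simp add: mult.commute distrib_left)
      finally show ?thesis .
    qed
  qed
  define E where "E = 1 + (\<Sum>\<tau>\<in>F. D \<tau>)"
  have E: "1 \<le> E" using D0 by (simp add: E_def sum_nonneg)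
  show ?case
  proof (intro exI[of _ "C * E"] conjI allI impI)
    show "0 \<le> C * E" using C(1) E by simp
    fix t assume t: "t \<notin> insert \<sigma> F"
    have "(\<Prod>\<tau>\<in>insert \<sigma> F. ?w \<tau> t) = (\<Prod>\<tau>\<in>F. ?w \<tau> t) * ?w \<sigma> t"
      using insert.hyps by (simp add: mult.commute)
    also have "\<dots> \<le> C * (1 + (\<Sum>\<tau>\<in>F. ?w \<tau> t)) * ?w \<sigma> t"
      using t by (intro mult_right_mono C(2)) auto
    also have "\<dots> = C * (?w \<sigma> t + (\<Sum>\<tau>\<in>F. ?w \<tau> t * ?w \<sigma> t))"
      by (simp add: algebra_simps sum_distrib_left sum_distrib_right)
    also have "\<dots> \<le> C * (E * (1 + (\<Sum>\<tau>\<in>insert \<sigma> F. ?w \<tau> t)))"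
    proof (intro mult_left_mono C(1))
      let ?S = "\<Sum>\<tau>\<in>insert \<sigma> F. ?w \<tau> t"
      have S: "?S = ?w \<sigma> t + (\<Sum>\<tau>\<in>F. ?w \<tau> t)" using insert.hyps by simp
      have le: "?w \<tau> t + ?w \<sigma> t \<le> ?S" if "\<tau> \<in> F" for \<tau>
        using member_le_sum[OF that, of "\<lambda>\<tau>. ?w \<tau> t"] insert.hyps by (simp add: S)
      have "(\<Sum>\<tau>\<in>F. ?w \<tau> t * ?w \<sigma> t) \<le> (\<Sum>\<tau>\<in>F. D \<tau> * ?S)"
        by (intro sum_mono order_trans[OF two[OF _ t]] mult_left_mono le D0)
      hence "?w \<sigma> t + (\<Sum>\<tau>\<in>F. ?w \<tau> t * ?w \<sigma> t) \<le> ?S + (\<Sum>\<tau>\<in>F. D \<tau>) * ?S"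
        unfolding sum_distrib_right[symmetric] using S sum_nonneg[of F "\<lambda>\<tau>. ?w \<tau> t"] by simp
      also have "\<dots> = E * ?S" by (simp add: E_def distrib_right)
      also have "\<dots> \<le> E * (1 + ?S)" using E by (intro mult_left_mono) auto
      finally show "?w \<sigma> t + (\<Sum>\<tau>\<in>F. ?w \<tau> t * ?w \<sigma> t) \<le> E * (1 + ?S)" .
    qed
    finally show "(\<Prod>\<tau>\<in>insert \<sigma> F. ?w \<tau> t) \<le> C * E * (1 + (\<Sum>\<tau>\<in>insert \<sigma> F. ?w \<tau> t))"
      by (simp only: mult.assoc)
  qed
qed

text \<open>The condition that the exponents lie below 1 takes effect here. After translation by
  \<tau> the window lies in [-Q, Q], where both halves reduce to the one-sided power on
  [0, Q].\<close>

lemma integrable_abs_powr: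
  fixes b \<tau> R :: real
  assumes b: "b < 1"
  shows "integrable lborel (\<lambda>t. \<bar>t - \<tau>\<bar> powr (- b) * indicator {-R..R} t)"
proof (cases "0 \<le> R")
  case True
  define Q where "Q = R + \<bar>\<tau>\<bar>"
  have Q: "0 \<le> Q" using True by (simp add: Q_def)
  have "(\<lambda>x. x powr (- b)) integrable_on {0..Q}"
    using b Q by (intro integrable_on_powr_from_0) auto
  hence "(\<lambda>x. x powr (- b)) absolutely_integrable_on {0..Q}"
    by (rule nonnegative_absolutely_integrable_1) auto
  hence "integrable lborel (\<lambda>x. indicator {0..Q} x *\<^sub>R x powr (- b))"
    unfolding set_integrable_def by (subst (asm) integrable_completion) auto
  hence pos: "integrable lborel (\<lambda>x. indicator {0..Q} x * x powr (- b))" by simp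
  have neg: "integrable lborel (\<lambda>x. indicator {0..Q} (- x) * (- x) powr (- b))"
    using lborel_integrable_real_affine[OF pos, of "-1" 0] by simp
  have "integrable lborel (\<lambda>x. \<bar>x\<bar> powr (- b) * indicator {-Q..Q} x)"
    by (rule Bochner_Integration.integrable_bound[OF Bochner_Integration.integrable_add[OF pos neg]])
       (auto simp: indicator_def)
  from lborel_integrable_real_affine[OF this, of 1 "- \<tau>"]
  have "integrable lborel (\<lambda>t. \<bar>t - \<tau>\<bar> powr (- b) * indicator {-Q..Q} (t - \<tau>))" by simp
  thus ?thesis
    by (rule Bochner_Integration.integrable_bound) (auto simp: indicator_def Q_def)
qed simp

text \<open>Meant for \<open>w\<close> the distance from a point of the half-plane to a singularity
  and \<open>d\<close> its projection to the boundary, so that the bound loses its dependence on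
  \<epsilon>. A positive exponent only grows when \<open>w\<close> shrinks to \<open>d\<close>; a
  negative one gives no singularity and is bounded by the size of the window.\<close>

lemma powr_le_singularity:
  fixes \<beta> T w d :: real
  assumes w: "0 < d" "d \<le> w" "w \<le> 1 + T" and T: "0 \<le> T"
  shows "w powr (- \<beta>) \<le> (1 + T) powr \<bar>\<beta>\<bar> * d powr (- max \<beta> 0)"
proof (cases "0 \<le> \<beta>")
  case True
  have "w powr (- \<beta>) \<le> d powr (- \<beta>)" using w True by (intro powr_mono2') auto
  also have "\<dots> \<le> (1 + T) powr \<beta> * d powr (- \<beta>)"
    using mult_right_mono[OF ge_one_powr_ge_zero[of "1 + T" \<beta>], of "d powr (- \<beta>)"] T True by simp
  finally show ?thesis using True by simp
next
  case False
  have "w powr (- \<beta>) \<le> (1 + T) powr (- \<beta>)" using w False by (intro powr_mono2) auto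
  thus ?thesis using False w by simp
qed

text \<open>The exponentiated hypothesis, with \<open>z\<close> standing for the zeta value at
  \<open>1 + s\<close>: \<open>- ln (norm s)\<close> cancels the \<open>s\<close> in the
  denominator, leaving only the singularities in \<open>F\<close>.\<close>

lemma norm_inverse_le_of_ln_lower_bound:
  fixes K :: real and \<beta> :: "real \<Rightarrow> real" and s z :: complex
  assumes s: "0 < Re s" and z: "z \<noteq> 0" and F: "finite F"
    and ln: "- K - ln (norm s) + (\<Sum>\<tau>\<in>F. \<beta> \<tau> * ln (norm (s - \<i> * of_real \<tau>))) < ln (norm z)"
  shows "norm (1 / (s * z)) \<le> exp K * (\<Prod>\<tau>\<in>F. norm (s - \<i> * of_real \<tau>) powr (- \<beta> \<tau>))"
proof -
  have s0: "s \<noteq> 0" and ne: "s - \<i> * of_real \<tau> \<noteq> 0" for \<tau> using s by (auto simp: complex_eq_iff)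
  have "norm (1 / (s * z)) = exp (- ln (norm s) - ln (norm z))"
    using s0 z by (simp add: norm_divide norm_mult exp_diff exp_minus field_simps)
  also have "\<dots> \<le> exp (K + (\<Sum>\<tau>\<in>F. - \<beta> \<tau> * ln (norm (s - \<i> * of_real \<tau>))))"
    using ln by (simp add: sum_negf)
  also have "\<dots> = exp K * (\<Prod>\<tau>\<in>F. norm (s - \<i> * of_real \<tau>) powr (- \<beta> \<tau>))"
    using F ne by (simp add: exp_add exp_sum powr_def)
  finally show ?thesis .
qed

theorem theorem5p1:
  fixes p :: "nat \<Rightarrow> real" and a :: real and S :: "real set" and \<beta> :: "real \<Rightarrow> real"
  assumes "beurling_primes p"
    and "a > 0"
    and "beurling_N p \<sim>[at_top] (\<lambda>x. a * x)"
    and "S \<subseteq> {0<..}"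
    and "\<And>T. finite {\<tau> \<in> S. \<tau> < T}"
    and "\<And>\<tau>. \<tau> \<in> S \<Longrightarrow> \<beta> \<tau> < 1"
    and "\<And>T. T > 0 \<Longrightarrow> \<exists>K>0. \<forall>t \<sigma>. 0 < t \<and> t < T \<and> 1 < \<sigma> \<and> \<sigma> < 2 \<longrightarrow>
           ln (cmod (beurling_zeta p (Complex \<sigma> t))) >
             - K - ln (cmod (Complex (\<sigma> - 1) t))
             + (\<Sum>\<tau> \<in> {\<tau> \<in> S. \<tau> < T}. \<beta> \<tau> * ln (cmod (Complex (\<sigma> - 1) (t - \<tau>))))"
  shows "(beurling_m p \<longlongrightarrow> 0) at_top"
proof -
  note p = assms(1) and N = assms(3)
  define f where "f u = beurling_m p (exp u)" for u
  note [measurable] = beurling_m_measurable[OF p]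
  have fm: "f \<in> borel_measurable borel" unfolding f_def by measurable
  obtain A where A: "\<And>h u. 0 \<le> h \<Longrightarrow> \<bar>f h - f u\<bar> \<le> A * (1 + \<bar>h - u\<bar>)"
    using beurling_m_exp_linear_osc[OF p N] unfolding f_def by blast
  define G where "G \<epsilon> t = (LINT u|lborel. of_real (f u * exp (- \<epsilon> * u)) * cis (- (t * u)))" for \<epsilon> t :: real
  have G: "G \<epsilon> t = 1 / (Complex \<epsilon> t * beurling_zeta p (Complex (1 + \<epsilon>) t))" if "0 < \<epsilon>" for \<epsilon> t
  proof -
    have "of_real (f u * exp (- \<epsilon> * u)) * cis (- (t * u)) =
        of_real (beurling_m p (exp u)) * exp (- Complex \<epsilon> t * of_real u)" for u
      by (simp add: f_def complex_eq_iff Re_exp Im_exp)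
    moreover have "1 + Complex \<epsilon> t = Complex (1 + \<epsilon>) t" by (simp add: complex_eq_iff)
    ultimately show ?thesis using laplace_beurling_m[OF p N, of "Complex \<epsilon> t"] that by (simp add: G_def)
  qed
  \<comment> \<open>The hypothesis covers positive \<open>t\<close> only. Since \<open>f\<close> is
    real, the transform at \<open>- t\<close> is the conjugate of the one at
    \<open>t\<close>.\<close>
  have G_cnj: "norm (G \<epsilon> (- t)) = norm (G \<epsilon> t)" for \<epsilon> t
  proof -
    have "G \<epsilon> (- t) = (LINT u|lborel. cnj (of_real (f u * exp (- \<epsilon> * u)) * cis (- (t * u))))"
      unfolding G_def by (intro Bochner_Integration.integral_cong refl) (simp add: cis_cnj)
    also have "\<dots> = cnj (G \<epsilon> t)" unfolding G_def by (rule Bochner_Integration.integral_cnj)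
    finally show ?thesis by simp
  qed
  have "(f \<longlongrightarrow> 0) at_top"
  proof (rule tauberian_slowly_oscillating[OF fm _ A])
    show "f u = 0" if "u < 0" for u using that beurling_m_eq_0[OF p] by (simp add: f_def)
    show "\<exists>\<delta>>0. \<exists>U. \<forall>u v. U \<le> u \<and> u \<le> v \<and> v \<le> u + \<delta> \<longrightarrow> \<bar>f v - f u\<bar> \<le> e" if "0 < e" for e
      unfolding f_def by (rule beurling_m_exp_slow_osc[OF p assms(2) N that])
    fix T :: real assume T: "0 < T"
    define F where "F = {\<tau> \<in> S. \<tau> < T}"
    have finF: "finite F" unfolding F_def by (rule assms(5))
    have F: "0 < \<tau>" "\<tau> < T" "\<beta> \<tau> < 1" if "\<tau> \<in> F" for \<tau>
      using that assms(4,6) by (auto simp: F_def)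
    obtain K where K: "\<And>t \<sigma>. 0 < t \<Longrightarrow> t < T \<Longrightarrow> 1 < \<sigma> \<Longrightarrow> \<sigma> < 2 \<Longrightarrow>
        - K - ln (cmod (Complex (\<sigma> - 1) t)) + (\<Sum>\<tau>\<in>F. \<beta> \<tau> * ln (cmod (Complex (\<sigma> - 1) (t - \<tau>))))
        < ln (cmod (beurling_zeta p (Complex \<sigma> t)))"
      using assms(7)[OF T] unfolding F_def by blast
    define b where "b \<tau> = max (\<beta> \<tau>) 0" for \<tau>
    obtain C where C: "0 \<le> C" "\<And>t. t \<notin> F \<Longrightarrow>
        (\<Prod>\<tau>\<in>F. \<bar>t - \<tau>\<bar> powr (- b \<tau>)) \<le> C * (1 + (\<Sum>\<tau>\<in>F. \<bar>t - \<tau>\<bar> powr (- b \<tau>)))"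
      using prod_singularities_le[OF finF, of b] by (auto simp: b_def)
    define D where "D = exp K * (\<Prod>\<tau>\<in>F. (1 + T) powr \<bar>\<beta> \<tau>\<bar>)"
    have D: "0 \<le> D" by (simp add: D_def prod_nonneg)
    have bound: "norm (G \<epsilon> t) \<le> D * C * (1 + (\<Sum>\<tau>\<in>F. \<bar>t - \<tau>\<bar> powr (- b \<tau>)))"
      if \<epsilon>: "0 < \<epsilon>" "\<epsilon> < 1" and t: "0 < t" "t < T" "t \<notin> F" for \<epsilon> t
    proof -
      have diff: "Complex \<epsilon> t - \<i> * of_real \<tau> = Complex \<epsilon> (t - \<tau>)" for \<tau> by (simp add: complex_eq_iff)
      have "beurling_zeta p (Complex (1 + \<epsilon>) t) \<noteq> 0"
        using beurling_zeta_identities(1)[OF p N, of "Complex (1 + \<epsilon>) t"] \<epsilon> by simp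
      hence "norm (G \<epsilon> t) \<le> exp K * (\<Prod>\<tau>\<in>F. norm (Complex \<epsilon> t - \<i> * of_real \<tau>) powr (- \<beta> \<tau>))"
        unfolding G[OF \<epsilon>(1)] using K[of t "1 + \<epsilon>"] t \<epsilon> finF
        by (intro norm_inverse_le_of_ln_lower_bound) (simp_all add: diff)
      also have "\<dots> \<le> exp K * (\<Prod>\<tau>\<in>F. (1 + T) powr \<bar>\<beta> \<tau>\<bar> * \<bar>t - \<tau>\<bar> powr (- b \<tau>))"
      proof (intro mult_left_mono prod_mono conjI)
        fix \<tau> assume \<tau>: "\<tau> \<in> F"
        have "\<bar>t - \<tau>\<bar> \<le> norm (Complex \<epsilon> (t - \<tau>))" using abs_Im_le_cmod[of "Complex \<epsilon> (t - \<tau>)"] by simp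
        moreover have "norm (Complex \<epsilon> (t - \<tau>)) \<le> 1 + T"
          using cmod_le[of "Complex \<epsilon> (t - \<tau>)"] \<epsilon> t F[OF \<tau>] by simp
        moreover have "0 < \<bar>t - \<tau>\<bar>" using t \<tau> by auto
        ultimately show "norm (Complex \<epsilon> t - \<i> * of_real \<tau>) powr (- \<beta> \<tau>) \<le> (1 + T) powr \<bar>\<beta> \<tau>\<bar> * \<bar>t - \<tau>\<bar> powr (- b \<tau>)"
          unfolding diff b_def using T by (intro powr_le_singularity) auto
      qed auto
      also have "\<dots> = D * (\<Prod>\<tau>\<in>F. \<bar>t - \<tau>\<bar> powr (- b \<tau>))" by (simp add: D_def prod.distrib)
      also have "\<dots> \<le> D * (C * (1 + (\<Sum>\<tau>\<in>F. \<bar>t - \<tau>\<bar> powr (- b \<tau>))))"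
        by (intro mult_left_mono C(2) D t)
      finally show ?thesis by (simp only: mult.assoc)
    qed
    define h where "h t = D * C * (indicator {-T..T} t + (\<Sum>\<tau>\<in>F. \<bar>t - \<tau>\<bar> powr (- b \<tau>) * indicator {-T..T} t))" for t
    have h: "integrable lborel h"
      unfolding h_def using T F
      by (intro integrable_mult_right Bochner_Integration.integrable_add Bochner_Integration.integrable_sum
            integrable_abs_powr) (auto simp: b_def)
    have h': "integrable lborel (\<lambda>t. h (- t))"
      using lborel_integrable_real_affine[OF h, of "-1" 0] by simp
    have h0: "0 \<le> h t" for t unfolding h_def using D C(1) by (intro mult_nonneg_nonneg add_nonneg_nonneg sum_nonneg) auto
    have hb: "norm (G \<epsilon> t) \<le> h t" if "0 < \<epsilon>" "\<epsilon> < 1" "0 < t" "t < T" "t \<notin> F" for \<epsilon> t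
      using bound[OF that] that by (simp add: h_def)
    show "\<exists>g. integrable lborel g \<and> (\<forall>\<epsilon>. 0 < \<epsilon> \<and> \<epsilon> < 1 \<longrightarrow>
      (AE t in lborel. \<bar>t\<bar> < T \<longrightarrow> norm (LINT u|lborel. of_real (f u * exp (- \<epsilon> * u)) * cis (- (t * u))) \<le> g t))"
    \<comment> \<open>The symmetrised majorant serves both signs of \<open>t\<close>: each summand
      is nonnegative, and one of them dominates.\<close>
    proof (intro exI[of _ "\<lambda>t. h t + h (- t)"] conjI allI impI)
      show "integrable lborel (\<lambda>t. h t + h (- t))" using h h' by simp
      fix \<epsilon> :: real assume \<epsilon>: "0 < \<epsilon> \<and> \<epsilon> < 1"
      \<comment> \<open>The excluded null set holds the singular points with their reflections, and
        0, which neither sign case reaches.\<close>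
      have "AE t in lborel. t \<notin> insert 0 (F \<union> uminus ` F)"
        using finF by (intro AE_not_in finite_imp_null_set_lborel) auto
      thus "AE t in lborel. \<bar>t\<bar> < T \<longrightarrow> norm (LINT u|lborel. of_real (f u * exp (- \<epsilon> * u)) * cis (- (t * u))) \<le> h t + h (- t)"
      proof eventually_elim
        case (elim t)
        have "norm (G \<epsilon> t) \<le> h t + h (- t)" if "\<bar>t\<bar> < T"
        proof (cases "0 < t")
          case True
          thus ?thesis using hb[of \<epsilon> t] h0[of "- t"] \<epsilon> elim that by auto
        next
          case False
          have "- t \<notin> F" using elim by (metis UnCI image_eqI insertCI minus_minus)
          thus ?thesis using hb[of \<epsilon> "- t"] h0[of t] G_cnj[of \<epsilon> t] \<epsilon> elim that False by auto
        qed
        thus ?case by (simp add: G_def)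
      qed
    qed
  qed
  hence "((\<lambda>x. f (ln x)) \<longlongrightarrow> 0) at_top" by (rule filterlim_compose[OF _ ln_at_top])
  moreover have "eventually (\<lambda>x. f (ln x) = beurling_m p x) at_top"
    using eventually_gt_at_top[of 0] by eventually_elim (simp add: f_def)
  ultimately show ?thesis by (rule Lim_transform_eventually)
qed

end
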